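(* Let $x_0$ be a nondegenerate $T$-periodic limit cycle of $\dot x=\psi(x)$. Assume that there exists $\theta_0\in[0,T]$ such that $f_{x_0}(\theta_0)=0$ and $f_{x_0}$ is strictly monotone at $\theta_0$. Then for all $\varepsilon>0$ sufficiently small the system $\dot x=\psi(x)+\varepsilon\phi(t,x,\varepsilon)$ possesses a $T$-periodic solution $x_\varepsilon$ satisfying $$x_\varepsilon(t)\to x_0(t+\theta_0)\quad\text{as }\varepsilon\to0,\qquad t\in[0,T].$$
   Context: Fix $T>0$ and $n\in\mathbb{N}$. Assumptions on $\psi$ and $\phi$: $\psi\in C^1(\mathbb{R}^n,\mathbb{R}^n)$; $\phi:\mathbb{R}\times\mathbb{R}^n\times[0,1]\to\mathbb{R}^n$ is $T$-periodic in its first variable and satisfies Carathéodory type conditions: $\phi(\cdot,x,\varepsilon)$ is Lebesgue measurable for each $(x,\varepsilon)$, $\phi(t,\cdot,\cdot)$ is continuous for a.a. $t$, and for each $r>0$ there is $b_r\in L^1([0,T],\mathbb{R}_+)$ with $|\phi(t,x,\varepsilon)|\le b_r(t)$ for a.a. $t\in[0,T]$ and all $|x|\le r$, $\varepsilon\in[0,1]$. A $T$-periodic solution is a solution $x\in C([0,T],\mathbb{R}^n)$ with $x(0)=x(T)$, extended to $\mathbb{R}$ by $T$-periodicity. A nondegenerate $T$-periodic limit cycle of $\dot x=\psi(x)$ is a nonconstant $T$-periodic solution $x_0$ such that the linearized $T$-periodic system $\dot y=\psi'(x_0(t))y$ has the characteristic (Floquet) multiplier $1$ with multiplicity $1$.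 The Malkin bifurcation function is $$f_{x_0}(\theta)=\mathrm{sign}\langle\dot x_0(0),z_0(0)\rangle\int_0^T\langle z_0(\tau),\phi(\tau-\theta,x_0(\tau),0)\rangle d\tau,$$ where $z_0$ is a nontrivial $T$-periodic solution of the adjoint system $\dot z=-(\psi'(x_0(t)))^*z$; it is defined for all $\theta\in\mathbb{R}$. "Strictly monotone at $\theta_0$" means: there is $\eta>0$ such that $(f_{x_0}(\theta)-f_{x_0}(\theta_0))(\theta-\theta_0)$ is nonzero and has constant sign for $0<|\theta-\theta_0|<\eta$. *)

theory Defs
  imports
    "HOL-Analysis.Analysis"
    "HOL-Computational_Algebra.Polynomial"
begin

definition T_periodic :: "real \<Rightarrow> (real \<Rightarrow> 'a) \<Rightarrow> bool" where
  "T_periodic T x \<longleftrightarrow> (\<forall>t. x (t + T) = x t)"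

definition C1_vector_field :: "(real^'n \<Rightarrow> real^'n) \<Rightarrow> bool" where
  "C1_vector_field \<psi> \<longleftrightarrow>
     (\<forall>x. \<psi> differentiable (at x)) \<and> continuous_on UNIV (\<lambda>x. jacobian \<psi> (at x))"

text \<open>The perturbation \<open>\<phi>\<close> is total in its last argument, but only its values for
  \<open>\<epsilon> \<in> [0,1]\<close> are constrained (and, below, only these are used).\<close>

definition caratheodory_perturbation ::
  "real \<Rightarrow> (real \<Rightarrow> real^'n \<Rightarrow> real \<Rightarrow> real^'n) \<Rightarrow> bool" where
  "caratheodory_perturbation T \<phi> \<longleftrightarrow>
     (\<forall>x. \<forall>\<epsilon>\<in>{0..1}. T_periodic T (\<lambda>t. \<phi> t x \<epsilon>)) \<and>
     (\<forall>x. \<forall>\<epsilon>\<in>{0..1}. (\<lambda>t. \<phi> t x \<epsilon>) \<in> borel_measurable lebesgue) \<and>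
     (AE t in lebesgue. continuous_on (UNIV \<times> {0..1}) (\<lambda>(x, \<epsilon>). \<phi> t x \<epsilon>)) \<and>
     (\<forall>r>0. \<exists>b :: real \<Rightarrow> real.
        set_integrable lebesgue {0..T} b \<and> (\<forall>t\<in>{0..T}. 0 \<le> b t) \<and>
        (AE t in lebesgue. t \<in> {0..T} \<longrightarrow>
           (\<forall>x. \<forall>\<epsilon>\<in>{0..1}. norm x \<le> r \<longrightarrow> norm (\<phi> t x \<epsilon>) \<le> b t)))"

text \<open>Solutions of a system with continuous right-hand side are classical ones.\<close>

definition classical_periodic_solution ::
  "real \<Rightarrow> (real \<Rightarrow> 'a \<Rightarrow> 'a) \<Rightarrow> (real \<Rightarrow> 'a::real_normed_vector) \<Rightarrow> bool" where
  "classical_periodic_solution T F x \<longleftrightarrow>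
     T_periodic T x \<and> (\<forall>t. (x has_vector_derivative F t (x t)) (at t))"

text \<open>Under Caratheodory conditions a solution is an absolutely continuous function satisfying
  the equation almost everywhere. Absolute continuity of a function (as opposed to a measure) is
  defined here by the usual condition on finite families of nonoverlapping intervals \<open>[a,b]\<close>,
  encoded as pairs \<open>(a,b)\<close>.\<close>

definition absolutely_continuous_fun_on ::
  "real set \<Rightarrow> (real \<Rightarrow> 'a::real_normed_vector) \<Rightarrow> bool" where
  "absolutely_continuous_fun_on S x \<longleftrightarrow>
     (\<forall>e>0. \<exists>d>0. \<forall>P :: (real \<times> real) set.
        finite P \<longrightarrow> (\<forall>(a, b)\<in>P. a \<le> b \<and> {a..b} \<subseteq> S) \<longrightarrow>
        pairwise (\<lambda>(a, b) (a', b'). {a<..<b} \<inter> {a'<..<b'} = {}) P \<longrightarrow>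
        (\<Sum>(a, b)\<in>P. b - a) < d \<longrightarrow>
        (\<Sum>(a, b)\<in>P. norm (x b - x a)) < e)"

text \<open>A solution on \<open>[0,T]\<close> with equal values at the endpoints, identified with its
  \<open>T\<close>-periodic extension to the real line.\<close>

definition caratheodory_periodic_solution ::
  "real \<Rightarrow> (real \<Rightarrow> 'a \<Rightarrow> 'a) \<Rightarrow> (real \<Rightarrow> 'a::real_normed_vector) \<Rightarrow> bool" where
  "caratheodory_periodic_solution T F x \<longleftrightarrow>
     T_periodic T x \<and> absolutely_continuous_fun_on {0..T} x \<and>
     (AE t in lebesgue. t \<in> {0..T} \<longrightarrow> (x has_vector_derivative F t (x t)) (at t))"

text \<open>The characteristic multipliers of the \<open>T\<close>-periodic system \<open>y' = A(t) y\<close> are the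
  eigenvalues of the monodromy matrix \<open>Y(T)\<close>, where \<open>Y\<close> is the fundamental matrix with
  \<open>Y(0) = I\<close>; multiplicities are algebraic.\<close>

definition monodromy_matrix ::
  "(real \<Rightarrow> real^'n^'n) \<Rightarrow> real \<Rightarrow> real^'n^'n \<Rightarrow> bool" where
  "monodromy_matrix A T M \<longleftrightarrow>
     (\<exists>Y. Y 0 = mat 1 \<and> (\<forall>t. (Y has_vector_derivative (A t ** Y t)) (at t)) \<and> M = Y T)"

definition characteristic_polynomial :: "real^'n^'n \<Rightarrow> real poly" where
  "characteristic_polynomial M =
     det (\<chi> i j. (if i = j then [:0, 1:] else 0) - [:M $ i $ j:])"

definition characteristic_multiplier ::
  "(real \<Rightarrow> real^'n^'n) \<Rightarrow> real \<Rightarrow> real \<Rightarrow> nat \<Rightarrow> bool" where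
  "characteristic_multiplier A T \<mu> m \<longleftrightarrow>
     (\<exists>M. monodromy_matrix A T M \<and> poly (characteristic_polynomial M) \<mu> = 0 \<and>
          order \<mu> (characteristic_polynomial M) = m)"

definition nondegenerate_limit_cycle ::
  "real \<Rightarrow> (real^'n \<Rightarrow> real^'n) \<Rightarrow> (real \<Rightarrow> real^'n) \<Rightarrow> bool" where
  "nondegenerate_limit_cycle T \<psi> x0 \<longleftrightarrow>
     classical_periodic_solution T (\<lambda>t x. \<psi> x) x0 \<and> \<not> x0 constant_on UNIV \<and>
     characteristic_multiplier (\<lambda>t. jacobian \<psi> (at (x0 t))) T 1 1"

definition nontrivial_periodic_adjoint_solution ::
  "real \<Rightarrow> (real^'n \<Rightarrow> real^'n) \<Rightarrow> (real \<Rightarrow> real^'n) \<Rightarrow> (real \<Rightarrow> real^'n) \<Rightarrow> bool" where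
  "nontrivial_periodic_adjoint_solution T \<psi> x0 z0 \<longleftrightarrow>
     classical_periodic_solution T
       (\<lambda>t z. - (transpose (jacobian \<psi> (at (x0 t))) *v z)) z0 \<and>
     (\<exists>t. z0 t \<noteq> 0)"

definition malkin_function ::
  "real \<Rightarrow> (real \<Rightarrow> real^'n \<Rightarrow> real \<Rightarrow> real^'n) \<Rightarrow> (real \<Rightarrow> real^'n) \<Rightarrow> (real \<Rightarrow> real^'n) \<Rightarrow>
     real \<Rightarrow> real" where
  "malkin_function T \<phi> x0 z0 \<theta> =
     sgn (vector_derivative x0 (at 0) \<bullet> z0 0) *
     (LINT \<tau>:{0..T}|lebesgue. z0 \<tau> \<bullet> \<phi> (\<tau> - \<theta>) (x0 \<tau>) 0)"

definition strictly_monotone_at :: "(real \<Rightarrow> real) \<Rightarrow> real \<Rightarrow> bool" where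
  "strictly_monotone_at f \<theta>0 \<longleftrightarrow>
     (\<exists>\<eta>>0.
        (\<forall>\<theta>. 0 < \<bar>\<theta> - \<theta>0\<bar> \<and> \<bar>\<theta> - \<theta>0\<bar> < \<eta> \<longrightarrow> (f \<theta> - f \<theta>0) * (\<theta> - \<theta>0) > 0) \<or>
        (\<forall>\<theta>. 0 < \<bar>\<theta> - \<theta>0\<bar> \<and> \<bar>\<theta> - \<theta>0\<bar> < \<eta> \<longrightarrow> (f \<theta> - f \<theta>0) * (\<theta> - \<theta>0) < 0))"

end

theory Submission
  imports Defs "HOL-Complex_Analysis.Great_Picard"
begin

text \<open>Let \<open>Y\<close> be the fundamental matrix of the system linearized along the cycle, \<open>Y(0) = I\<close>, let \<open>V\<close> be its
inverse and \<open>M = Y(T)\<close>. In the variables \<open>x(t) = x\<^sub>0(t + \<theta>) + Y(t + \<theta>) u(t)\<close> the linear part of the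
perturbed system cancels, and the equation becomes \<open>u' = V(t + \<theta>) (remainder + \<epsilon> \<phi>)\<close>, where the
remainder of the linearization of \<open>\<psi>\<close> is \<open>o(|u|)\<close>. The right-hand side is the function \<open>drift\<close> below. With
\<open>q = u(T) - u(0)\<close>, the function \<open>x\<close> closes up after time \<open>T\<close> if and only if \<open>M (u(0) + q) = u(0)\<close>.

The vector \<open>\<zeta> = z\<^sub>0(0)\<close> is fixed by the transpose of \<open>M\<close>. Since \<open>1\<close> is a simple multiplier, the closing
condition can be solved for \<open>u(0)\<close> as soon as \<open>\<zeta> \<bullet> q = 0\<close>, and then \<open>u(0) = L q\<close> for a constant matrix \<open>L\<close>
(\<open>periodic_boundary_operator\<close>). What remains is the scalar equation \<open>\<zeta> \<bullet> q = 0\<close> for the phase \<open>\<theta>\<close>. As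
\<open>\<zeta> \<bullet> V(\<tau>) h = z\<^sub>0(\<tau>) \<bullet> h\<close>, the quotient \<open>(\<zeta> \<bullet> q) / \<epsilon>\<close> tends to the integral of
\<open>z\<^sub>0(t + \<theta>) \<bullet> \<phi>(t, x\<^sub>0(t + \<theta>), 0)\<close> when \<open>\<epsilon> \<rightarrow> 0\<close> and \<open>u = O(\<epsilon>)\<close>
(\<open>scaled_boundary_integral_tendsto\<close>); by periodicity this is the Malkin function up to its constant
factor (\<open>malkin_function_eq_bifurcation\<close>). The factor is not zero, because otherwise the Malkin function
would vanish identically and could not be strictly monotone at \<open>\<theta>\<^sub>0\<close>. Hence \<open>\<zeta> \<bullet> q\<close> has opposite signs at
\<open>\<theta>\<^sub>0 - \<delta>\<close> and \<open>\<theta>\<^sub>0 + \<delta>\<close> for all small \<open>\<epsilon>\<close>, whichever admissible \<open>u\<close> is inserted.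

Under Caratheodory conditions solutions need not be unique, so there is no period map to which a
degree argument could be applied. Instead \<open>\<theta>\<close>, \<open>u(0)\<close> and \<open>u\<close> are found together, as a fixed point of
\<open>(\<theta>, u(0)) \<mapsto> (\<theta> - s (\<zeta> \<bullet> q), L q)\<close>, cut off to a compact convex set of parameters and coupled to the
integral equation for \<open>u\<close>. At a fixed point the cut-off is inactive: in \<open>\<theta>\<close> because of the signs of
\<open>\<zeta> \<bullet> q\<close> at the two ends, in \<open>u\<close> because the drift is small. Such fixed points exist by
\<open>volterra_boundary_fixed_point\<close>: Euler polygons depend continuously on the parameters, which leaves
Brouwer's theorem for a finite-dimensional map, and the Arzela-Ascoli theorem removes the
discretization.

This gives, for every \<open>\<delta>\<close>, solutions with \<open>|\<theta> - \<theta>\<^sub>0| \<le> \<delta>\<close> and \<open>u = O(\<epsilon>)\<close> for all small \<open>\<epsilon>\<close>, so nearly optimal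
choices converge to the shifted cycle (\<open>choose_convergent_family\<close>).\<close>

section \<open>Caratheodory right-hand sides\<close>

text \<open>Null sets are removed and arguments cut off before this predicate is used. Continuity and domination
can therefore be demanded at every point of \<open>S\<close> and for all arguments.\<close>

definition caratheodory_on ::
  "real set \<Rightarrow> (real \<Rightarrow> real) \<Rightarrow> (real \<Rightarrow> 'a::euclidean_space \<Rightarrow> 'b::euclidean_space) \<Rightarrow> bool" where
  "caratheodory_on S m F \<longleftrightarrow>
     (\<forall>x. (\<lambda>t. F t x) \<in> borel_measurable (lebesgue_on S)) \<and>
     (\<forall>t\<in>S. continuous_on UNIV (F t)) \<and>
     m integrable_on S \<and> (\<forall>t\<in>S. \<forall>x. norm (F t x) \<le> m t)"

text \<open>For a simple function \<open>y\<close> the superposition is pieced together from finitely many of the measurable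
functions \<open>F(\<cdot>, x)\<close>; continuity in the second argument carries measurability over to pointwise limits.\<close>

lemma borel_measurable_superposition:
  fixes F :: "real \<Rightarrow> 'a::euclidean_space \<Rightarrow> 'b::euclidean_space"
  assumes meas: "\<And>x. (\<lambda>t. F t x) \<in> borel_measurable (lebesgue_on S)"
    and cont: "\<And>t. t \<in> S \<Longrightarrow> continuous_on UNIV (F t)"
    and y: "y \<in> borel_measurable (lebesgue_on S)"
  shows "(\<lambda>t. F t (y t)) \<in> borel_measurable (lebesgue_on S)"
proof -
  obtain g where g: "\<And>n::nat. g n \<in> borel_measurable (lebesgue_on S)"
    and fin: "\<And>n. finite (range (g n))" and lim: "\<And>t. (\<lambda>n. g n t) \<longlonglongrightarrow> y t"
    using iffD1[OF borel_measurable_simple_function_limit y] by blast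
  have "(\<lambda>t. F t (g n t)) \<in> borel_measurable (lebesgue_on S)" for n
  proof (rule measurable_compose_countable'[where I = "range (g n)" and g = "g n" and f = "\<lambda>x t. F t x"])
    show "g n \<in> measurable (lebesgue_on S) (count_space (range (g n)))"
    proof (subst measurable_count_space_eq2[OF fin], intro conjI ballI)
      show "g n \<in> space (lebesgue_on S) \<rightarrow> range (g n)" by auto
      show "g n -` {a} \<inter> space (lebesgue_on S) \<in> sets (lebesgue_on S)" for a
        using measurable_sets[OF g[of n], of "{a}"] by simp
    qed
  qed (use meas fin in \<open>auto intro: countable_finite\<close>)
  moreover have "(\<lambda>n. F t (g n t)) \<longlonglongrightarrow> F t (y t)" if "t \<in> space (lebesgue_on S)" for t
    using that cont[of t] lim[of t]
    by (metis UNIV_I continuous_on_tendsto_compose eventually_sequentiallyI space_restrict_space Int_iff)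
  ultimately show ?thesis
    by (rule borel_measurable_LIMSEQ_metric)
qed

lemma caratheodory_on_subset:
  assumes "caratheodory_on {a..b} m F" "{c..d} \<subseteq> {a..b}"
  shows "caratheodory_on {c..d} m F"
proof -
  have "m integrable_on {c..d}"
    using assms unfolding caratheodory_on_def by (blast intro: integrable_subinterval_real)
  moreover have "(\<lambda>t. F t x) \<in> borel_measurable (lebesgue_on {c..d})" for x
    using assms measurable_restrict_mono unfolding caratheodory_on_def by blast
  ultimately show ?thesis
    using assms unfolding caratheodory_on_def by blast
qed

lemma caratheodory_on_integrable:
  fixes F :: "real \<Rightarrow> 'a::euclidean_space \<Rightarrow> 'b::euclidean_space"
  assumes F: "caratheodory_on {a..b} m F"
    and y: "y \<in> borel_measurable (lebesgue_on {a..b})"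
  shows "(\<lambda>t. F t (y t)) absolutely_integrable_on {a..b}"
    and "norm (integral {a..b} (\<lambda>t. F t (y t))) \<le> integral {a..b} m"
proof -
  show ai: "(\<lambda>t. F t (y t)) absolutely_integrable_on {a..b}"
  proof (rule measurable_bounded_by_integrable_imp_absolutely_integrable)
    show "(\<lambda>t. F t (y t)) \<in> borel_measurable (lebesgue_on {a..b})"
      by (rule borel_measurable_superposition) (use F y in \<open>auto simp only: caratheodory_on_def\<close>)
  qed (use F in \<open>auto simp: caratheodory_on_def\<close>)
  show "norm (integral {a..b} (\<lambda>t. F t (y t))) \<le> integral {a..b} m"
    using F set_lebesgue_integral_eq_integral(1)[OF ai] unfolding caratheodory_on_def
    by (intro integral_norm_bound_integral) auto
qed

text \<open>Dominated convergence. The limit \<open>z\<close> may be any pointwise limit, so this covers both the continuity of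
the discretized flow and the passage from polygons to solutions.\<close>

lemma caratheodory_on_integral_tendsto:
  fixes F :: "real \<Rightarrow> 'a::euclidean_space \<Rightarrow> 'b::euclidean_space"
  assumes F: "caratheodory_on {a..b} m F"
    and y: "\<And>k::nat. y k \<in> borel_measurable (lebesgue_on {a..b})"
    and lim: "\<And>t. t \<in> {a..b} \<Longrightarrow> (\<lambda>k. y k t) \<longlonglongrightarrow> z t"
  shows "(\<lambda>k. integral {a..b} (\<lambda>t. F t (y k t))) \<longlonglongrightarrow> integral {a..b} (\<lambda>t. F t (z t))"
proof (rule dominated_convergence(2)[where h = m])
  show "(\<lambda>t. F t (y k t)) integrable_on {a..b}" for k
    using caratheodory_on_integrable(1)[OF F y] set_lebesgue_integral_eq_integral(1) by blast
  show "(\<lambda>k. F t (y k t)) \<longlonglongrightarrow> F t (z t)" if "t \<in> {a..b}" for t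
    using F lim[OF that] that unfolding caratheodory_on_def
    by (metis UNIV_I continuous_on_tendsto_compose eventually_sequentiallyI)
qed (use F in \<open>auto simp: caratheodory_on_def\<close>)

lemma continuous_on_caratheodory_integral:
  fixes F :: "real \<Rightarrow> 'a::euclidean_space \<Rightarrow> 'b::euclidean_space"
  assumes F: "caratheodory_on {a..b} m F"
  shows "continuous_on UNIV (\<lambda>x. integral {a..b} (\<lambda>t. F t x))"
  unfolding continuous_on_sequentially
  by (auto simp: o_def intro!: caratheodory_on_integral_tendsto[OF F])

section \<open>Volterra equations coupled to a boundary condition\<close>

text \<open>Freezing \<open>u\<close> on each cell of a grid turns the integral equation into a finite recursion whose values
\<open>a p i\<close> at the grid points depend continuously on the parameter \<open>p\<close>. Brouwer's theorem then applies to
\<open>p \<mapsto> \<gamma>(p, a p N - \<iota> p)\<close>. The step function \<open>y\<close> of frozen values solves the integral equation up to a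
delay of at most the mesh size, which is all that the limit passage uses.\<close>

lemma euler_polygon_fixed_point:
  fixes G :: "real \<Rightarrow> 'e::euclidean_space \<times> 'f::euclidean_space \<Rightarrow> 'f"
  assumes T: "T > 0" and N: "N > (0::nat)"
    and G: "caratheodory_on {0..T} m G"
    and P: "compact P" "convex P" "P \<noteq> {}"
    and \<iota>: "continuous_on P \<iota>"
    and \<gamma>: "continuous_on (P \<times> UNIV) \<gamma>" "\<And>p q. p \<in> P \<Longrightarrow> \<gamma> (p, q) \<in> P"
  obtains p y where "p \<in> P"
    and "y \<in> borel_measurable (lebesgue_on {0..T})"
    and "\<And>s. s \<in> {0..T} \<Longrightarrow> \<exists>r\<in>{0..T}. \<bar>s - r\<bar> \<le> T / N \<and>
            y s = \<iota> p + integral {0..r} (\<lambda>s. G s (p, y s))"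
    and "\<gamma> (p, integral {0..T} (\<lambda>s. G s (p, y s))) = p"
proof -
  define tt where "tt i = real i * T / N" for i :: nat
  define a where "a p i = rec_nat (\<iota> p)
     (\<lambda>i v. v + integral {tt i..tt (Suc i)} (\<lambda>s. G s (p, v))) i" for p i
  have a0: "a p 0 = \<iota> p" for p by (simp add: a_def)
  have aS: "a p (Suc i) = a p i + integral {tt i..tt (Suc i)} (\<lambda>s. G s (p, a p i))" for p i
    by (simp add: a_def)
  have tt0: "tt 0 = 0" and ttN: "tt N = T" using N by (auto simp: tt_def)
  have tt_nonneg: "0 \<le> tt i" for i using T by (simp add: tt_def)
  have tt_le: "tt i \<le> T" if "i \<le> N" for i
    using that T N by (simp add: tt_def divide_le_eq mult.commute mult_left_mono)
  have tt_Suc: "tt (Suc i) = tt i + T / N" for i by (simp add: tt_def add_divide_distrib algebra_simps)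
  have tt_mono: "tt i \<le> tt (Suc i)" for i using T by (simp add: tt_Suc)
  have cont_a: "i \<le> N \<Longrightarrow> continuous_on P (\<lambda>p. a p i)" for i
  proof (induction i)
    case 0 then show ?case using \<iota> by (simp add: a0)
  next
    case (Suc i)
    have "caratheodory_on {tt i..tt (Suc i)} m G"
      by (rule caratheodory_on_subset[OF G]) (use tt_nonneg[of i] tt_le[OF Suc.prems] in auto)
    from continuous_on_caratheodory_integral[OF this]
    have "continuous_on P (\<lambda>p. integral {tt i..tt (Suc i)} (\<lambda>s. G s (p, a p i)))"
      by (rule continuous_on_compose2[where f = "\<lambda>p. (p, a p i)"])
         (use Suc in \<open>auto intro!: continuous_intros\<close>)
    then show ?case using Suc by (auto simp: aS intro!: continuous_intros)
  qed
  have "continuous_on P (\<lambda>p. \<gamma> (p, a p N - \<iota> p))"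
    by (rule continuous_on_compose2[OF \<gamma>(1)])
       (use cont_a[of N] \<iota> in \<open>auto intro!: continuous_intros\<close>)
  then obtain p where p: "p \<in> P" "\<gamma> (p, a p N - \<iota> p) = p"
    using brouwer[OF P, of "\<lambda>p. \<gamma> (p, a p N - \<iota> p)"] \<gamma>(2) by blast
  define idx where "idx s = nat \<lfloor>s * N / T\<rfloor>" for s :: real
  define y where "y s = a p (idx s)" for s
  have idx_eq: "idx s = i" if "tt i \<le> s" "s < tt (Suc i)" for s i
  proof -
    have "\<lfloor>s * N / T\<rfloor> = int i"
      using that T N unfolding tt_def
      by (intro floor_unique) (auto simp: field_simps)
    then show ?thesis by (simp add: idx_def)
  qed
  have "y \<in> borel_measurable lborel"
    unfolding y_def idx_def by measurable
  then have y_meas: "y \<in> borel_measurable (lebesgue_on {0..T})"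
    by (intro measurable_restrict_space1 measurable_completion) auto
  define I where "I r = integral {0..r} (\<lambda>s. G s (p, y s))" for r
  have "(\<lambda>s. (p, y s)) \<in> borel_measurable (lebesgue_on {0..T})"
    using y_meas by measurable
  then have int: "(\<lambda>s. G s (p, y s)) integrable_on {0..T}"
    using caratheodory_on_integrable(1)[OF G] set_lebesgue_integral_eq_integral(1) by blast
  \<comment> \<open>On the cell between two grid points the frozen value is constant except at the right endpoint,
    where the index jumps; a single point does not affect the integral.\<close>
  have grid: "i \<le> N \<Longrightarrow> a p i = \<iota> p + I (tt i)" for i
  proof (induction i)
    case 0 then show ?case by (simp add: a0 I_def tt0)
  next
    case (Suc i)
    have "I (tt (Suc i)) = I (tt i) + integral {tt i..tt (Suc i)} (\<lambda>s. G s (p, y s))"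
      unfolding I_def
      by (rule Henstock_Kurzweil_Integration.integral_combine[symmetric])
         (use tt_nonneg tt_mono tt_le[OF Suc.prems] in \<open>auto intro: integrable_subinterval_real[OF int]\<close>)
    also have "integral {tt i..tt (Suc i)} (\<lambda>s. G s (p, y s))
             = integral {tt i..tt (Suc i)} (\<lambda>s. G s (p, a p i))"
      by (rule integral_spike[of "{tt (Suc i)}"]) (auto simp: y_def idx_eq)
    finally show ?case using Suc by (simp add: aS)
  qed
  show thesis
  proof
    show "p \<in> P" by fact
    show "y \<in> borel_measurable (lebesgue_on {0..T})" by fact
    show "\<gamma> (p, integral {0..T} (\<lambda>s. G s (p, y s))) = p"
      using p(2) grid[of N] by (simp add: ttN I_def)
    show "\<exists>r\<in>{0..T}. \<bar>s - r\<bar> \<le> T / N \<and> y s = \<iota> p + integral {0..r} (\<lambda>s. G s (p, y s))"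
      if s: "s \<in> {0..T}" for s
    proof (intro bexI conjI)
      have fl: "real (idx s) \<le> s * N / T" "s * N / T < real (idx s) + 1"
        using s T unfolding idx_def by (auto simp: of_nat_nat)
      have "s * N / T \<le> N" using s T by (simp add: divide_le_eq mult.commute mult_right_mono)
      then have le: "idx s \<le> N" using fl by linarith
      show "tt (idx s) \<in> {0..T}" using tt_nonneg tt_le[OF le] by auto
      have "tt (idx s) \<le> s" "s \<le> tt (idx s) + T / N"
        using fl T N unfolding tt_def by (auto simp: field_simps)
      then show "\<bar>s - tt (idx s)\<bar> \<le> T / N" by auto
      show "y s = \<iota> p + integral {0..tt (idx s)} (\<lambda>s. G s (p, y s))"
        using grid[OF le] by (simp add: y_def I_def)
    qed
  qed
qed

text \<open>A substitute for Leray-Schauder degree theory in which only finitely many parameters are unknown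
besides the solution of the Volterra equation. The polygons for mesh size \<open>T / (k + 1)\<close> share the
modulus of continuity of \<open>t \<mapsto> \<integral>\<^sub>0\<^sup>t m\<close>, so a subsequence converges uniformly; the delay tends to zero
with the mesh size.\<close>

lemma volterra_boundary_fixed_point:
  fixes G :: "real \<Rightarrow> 'e::euclidean_space \<times> 'f::euclidean_space \<Rightarrow> 'f"
  assumes T: "T > 0"
    and G: "caratheodory_on {0..T} m G"
    and P: "compact P" "convex P" "P \<noteq> {}"
    and \<iota>: "continuous_on P \<iota>"
    and \<gamma>: "continuous_on (P \<times> UNIV) \<gamma>" "\<And>p q. p \<in> P \<Longrightarrow> \<gamma> (p, q) \<in> P"
  obtains p u where "p \<in> P"
    and "continuous_on {0..T} u"
    and "\<And>t. t \<in> {0..T} \<Longrightarrow> u t = \<iota> p + integral {0..t} (\<lambda>s. G s (p, u s))"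
    and "\<gamma> (p, integral {0..T} (\<lambda>s. G s (p, u s))) = p"
proof -
  define Q where "Q k p y \<longleftrightarrow> p \<in> P \<and> y \<in> borel_measurable (lebesgue_on {0..T}) \<and>
     (\<forall>s\<in>{0..T}. \<exists>r\<in>{0..T}. \<bar>s - r\<bar> \<le> T / Suc k \<and>
            y s = \<iota> p + integral {0..r} (\<lambda>s. G s (p, y s))) \<and>
     \<gamma> (p, integral {0..T} (\<lambda>s. G s (p, y s))) = p" for k p y
  have "\<exists>p y. Q k p y" for k
  proof (rule euler_polygon_fixed_point[OF T zero_less_Suc[of k] G P \<iota> \<gamma>])
    fix p y
    assume "p \<in> P" "y \<in> borel_measurable (lebesgue_on {0..T})"
      "\<And>s. s \<in> {0..T} \<Longrightarrow> \<exists>r\<in>{0..T}. \<bar>s - r\<bar> \<le> T / Suc k \<and>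
            y s = \<iota> p + integral {0..r} (\<lambda>s. G s (p, y s))"
      "\<gamma> (p, integral {0..T} (\<lambda>s. G s (p, y s))) = p"
    then have "Q k p y" unfolding Q_def by blast
    then show ?thesis by blast
  qed
  then obtain p y where "\<And>k. Q k (p k) (y k)" by metis
  then have pP: "\<And>k. p k \<in> P"
    and y_meas: "\<And>k. y k \<in> borel_measurable (lebesgue_on {0..T})"
    and yr: "\<And>k s. s \<in> {0..T} \<Longrightarrow> \<exists>r\<in>{0..T}. \<bar>s - r\<bar> \<le> T / Suc k \<and>
            y k s = \<iota> (p k) + integral {0..r} (\<lambda>s. G s (p k, y k s))"
    and fp: "\<And>k. \<gamma> (p k, integral {0..T} (\<lambda>s. G s (p k, y k s))) = p k"
    unfolding Q_def by blast+
  define u where "u k t = \<iota> (p k) + integral {0..t} (\<lambda>s. G s (p k, y k s))" for k t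
  define E where "E t = integral {0..t} m" for t
  have m: "m integrable_on {0..T}" using G by (simp add: caratheodory_on_def)
  have py_meas: "(\<lambda>s. (p k, y k s)) \<in> borel_measurable (lebesgue_on S)"
    if "S \<subseteq> {0..T}" for k S
  proof -
    have "y k \<in> borel_measurable (lebesgue_on S)"
      using y_meas that by (rule measurable_restrict_mono)
    then show ?thesis by measurable
  qed
  have int: "(\<lambda>s. G s (p k, y k s)) integrable_on {0..T}" for k
    using caratheodory_on_integrable(1)[OF G py_meas] set_lebesgue_integral_eq_integral(1) by blast
  have mod': "norm (u k t - u k s) \<le> \<bar>E t - E s\<bar>" if "0 \<le> s" "s \<le> t" "t \<le> T" for k s t
  proof -
    have "u k t - u k s = integral {s..t} (\<lambda>s. G s (p k, y k s))"
      using Henstock_Kurzweil_Integration.integral_combine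
        [OF that(1,2) integrable_subinterval_real[OF int[of k]]] that
      by (auto simp: u_def algebra_simps)
    also have "norm \<dots> \<le> integral {s..t} m"
      by (rule caratheodory_on_integrable(2)[OF caratheodory_on_subset[OF G] py_meas]) (use that in auto)
    also have "\<dots> = E t - E s"
      using Henstock_Kurzweil_Integration.integral_combine
        [OF that(1,2) integrable_subinterval_real[OF m]] that
      by (auto simp: E_def algebra_simps)
    finally show ?thesis by linarith
  qed
  have mod: "norm (u k t - u k s) \<le> \<bar>E t - E s\<bar>" if "s \<in> {0..T}" "t \<in> {0..T}" for k s t
    using mod'[of s t k] mod'[of t s k] that by (cases "s \<le> t") (auto simp: norm_minus_commute abs_minus_commute)
  have E_cont: "continuous_on {0..T} E"
    unfolding E_def by (rule indefinite_integral_continuous_1[OF m])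
  have E_unif: "uniformly_continuous_on {0..T} E"
    by (rule compact_uniformly_continuous[OF E_cont]) simp
  obtain p' \<sigma> where p': "p' \<in> P" "strict_mono (\<sigma> :: nat \<Rightarrow> nat)" "(p \<circ> \<sigma>) \<longlonglongrightarrow> p'"
    using P(1) pP unfolding compact_def by metis
  obtain B where B: "\<And>x. x \<in> P \<Longrightarrow> norm (\<iota> x) \<le> B"
    using compact_imp_bounded[OF compact_continuous_image[OF \<iota> P(1)]]
    unfolding bounded_iff by blast
  have E0: "E 0 = 0" by (simp add: E_def)
  obtain g \<kappa> where g: "continuous_on {0..T} g" "strict_mono (\<kappa> :: nat \<Rightarrow> nat)"
    and lim: "\<And>e. 0 < e \<Longrightarrow> \<exists>N. \<forall>n x. n \<ge> N \<and> x \<in> {0..T} \<longrightarrow> norm (u (\<sigma> (\<kappa> n)) x - g x) < e"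
  proof (rule Arzela_Ascoli[of "{0..T}" "\<lambda>n. u (\<sigma> n)" "B + (SUP t\<in>{0..T}. \<bar>E t\<bar>)"])
    show "norm (u (\<sigma> n) t) \<le> B + (SUP t\<in>{0..T}. \<bar>E t\<bar>)" if t: "t \<in> {0..T}" for n t
    proof -
      have bdd: "bdd_above ((\<lambda>t. \<bar>E t\<bar>) ` {0..T})"
        by (intro compact_imp_bounded[THEN bounded_imp_bdd_above] compact_continuous_image continuous_intros E_cont) auto
      have "norm (u (\<sigma> n) t) \<le> norm (u (\<sigma> n) 0) + norm (u (\<sigma> n) t - u (\<sigma> n) 0)"
        by (metis add.commute norm_triangle_sub)
      also have "\<dots> \<le> B + \<bar>E t\<bar>"
        using B[OF pP] mod[of 0 t "\<sigma> n"] t T by (intro add_mono) (auto simp: u_def E0)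
      also have "\<bar>E t\<bar> \<le> (SUP t\<in>{0..T}. \<bar>E t\<bar>)"
        by (rule cSUP_upper[OF t bdd])
      finally show ?thesis by simp
    qed
    show "\<exists>d>0. \<forall>n y. y \<in> {0..T} \<and> norm (x - y) < d \<longrightarrow> norm (u (\<sigma> n) x - u (\<sigma> n) y) < e"
      if "x \<in> {0..T}" "0 < e" for x e
    proof -
      obtain d where "d > 0" "\<And>y. y \<in> {0..T} \<Longrightarrow> dist y x < d \<Longrightarrow> dist (E y) (E x) < e"
        using E_unif \<open>0 < e\<close> \<open>x \<in> {0..T}\<close> unfolding uniformly_continuous_on_def by metis
      then show ?thesis using mod[OF _ \<open>x \<in> {0..T}\<close>]
        by (intro exI[of _ d]) (auto simp: dist_real_def abs_minus_commute intro!: le_less_trans[OF mod[OF _ \<open>x \<in> {0..T}\<close>]])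
    qed
  qed auto
  define \<tau> where "\<tau> = \<sigma> \<circ> \<kappa>"
  have \<tau>: "strict_mono \<tau>" unfolding \<tau>_def by (rule strict_mono_o[OF p'(2) g(2)])
  have p_lim: "(\<lambda>n. p (\<tau> n)) \<longlonglongrightarrow> p'"
    using LIMSEQ_subseq_LIMSEQ[OF p'(3) g(2)] by (simp add: \<tau>_def o_def)
  have u_lim: "(\<lambda>n. u (\<tau> n) t) \<longlonglongrightarrow> g t" if "t \<in> {0..T}" for t
    unfolding LIMSEQ_def dist_norm using lim that by (fastforce simp: \<tau>_def)
  have y_lim: "(\<lambda>n. y (\<tau> n) t) \<longlonglongrightarrow> g t" if t: "t \<in> {0..T}" for t
  proof -
    have "(\<lambda>n. y (\<tau> n) t - u (\<tau> n) t) \<longlonglongrightarrow> 0"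
      unfolding LIMSEQ_def
    proof (intro allI impI)
      fix e :: real assume "e > 0"
      then obtain d where d: "d > 0" "\<And>y. y \<in> {0..T} \<Longrightarrow> dist y t < d \<Longrightarrow> dist (E y) (E t) < e"
        using E_unif t unfolding uniformly_continuous_on_def by metis
      obtain M :: nat where M: "T / d < M" using reals_Archimedean2 by blast
      have "dist (y (\<tau> n) t - u (\<tau> n) t) 0 < e" if "n \<ge> M" for n
      proof -
        obtain r where r: "r \<in> {0..T}" "\<bar>t - r\<bar> \<le> T / Suc (\<tau> n)" "y (\<tau> n) t = u (\<tau> n) r"
          using yr[OF t] unfolding u_def by blast
        have "real M \<le> Suc (\<tau> n)"
          using that strict_mono_imp_increasing[OF \<tau>, of n] by linarith
        then have "T / d < Suc (\<tau> n)" using M by linarith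
        then have "T / Suc (\<tau> n) < d" using d(1) by (simp add: field_simps)
        then have "dist (E r) (E t) < e" using d(2)[OF r(1)] r(2) by (auto simp: dist_real_def)
        then show ?thesis using mod[OF t r(1), of "\<tau> n"] r(3) by (simp add: dist_real_def dist_norm)
      qed
      then show "\<exists>no. \<forall>n\<ge>no. dist (y (\<tau> n) t - u (\<tau> n) t) 0 < e" by blast
    qed
    from tendsto_add[OF this u_lim[OF t]] show ?thesis by simp
  qed
  have I_lim: "(\<lambda>n. integral {0..t} (\<lambda>s. G s (p (\<tau> n), y (\<tau> n) s))) \<longlonglongrightarrow> integral {0..t} (\<lambda>s. G s (p', g s))"
    if "t \<in> {0..T}" for t
    by (rule caratheodory_on_integral_tendsto[OF caratheodory_on_subset[OF G] py_meas])
       (use that p_lim y_lim in \<open>auto intro: tendsto_Pair\<close>)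
  have \<iota>_lim: "(\<lambda>n. \<iota> (p (\<tau> n))) \<longlonglongrightarrow> \<iota> p'"
    by (rule continuous_on_tendsto_compose[OF \<iota> p_lim p'(1)]) (simp add: pP)
  show thesis
  proof
    show "p' \<in> P" "continuous_on {0..T} g" by fact+
    show "g t = \<iota> p' + integral {0..t} (\<lambda>s. G s (p', g s))" if "t \<in> {0..T}" for t
    proof (rule LIMSEQ_unique[OF u_lim[OF that]])
      show "(\<lambda>n. u (\<tau> n) t) \<longlonglongrightarrow> \<iota> p' + integral {0..t} (\<lambda>s. G s (p', g s))"
        unfolding u_def by (intro tendsto_add \<iota>_lim I_lim that)
    qed
    have "(\<lambda>n. \<gamma> (p (\<tau> n), integral {0..T} (\<lambda>s. G s (p (\<tau> n), y (\<tau> n) s))))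
        \<longlonglongrightarrow> \<gamma> (p', integral {0..T} (\<lambda>s. G s (p', g s)))"
      by (rule continuous_on_tendsto_compose[OF \<gamma>(1)])
         (use T p'(1) pP in \<open>auto intro!: tendsto_Pair p_lim I_lim\<close>)
    then have "(\<lambda>n. p (\<tau> n)) \<longlonglongrightarrow> \<gamma> (p', integral {0..T} (\<lambda>s. G s (p', g s)))"
      by (simp add: fp)
    then show "\<gamma> (p', integral {0..T} (\<lambda>s. G s (p', g s))) = p'"
      using p_lim LIMSEQ_unique by blast
  qed
qed

section \<open>Indefinite integrals and periodic functions\<close>

text \<open>Lebesgue's differentiation theorem on the line. At almost every point the averages over short
intervals to the right converge to the value of the integrand; applied to the reflected integrand
the same fact controls the averages to the left.\<close>

lemma indefinite_integral_AE_vector_derivative: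
  fixes f :: "real \<Rightarrow> 'a::euclidean_space"
  assumes f: "f integrable_on {a..b}"
  shows "AE t in lebesgue. t \<in> {a<..<b} \<longrightarrow>
           ((\<lambda>t. integral {a..t} f) has_vector_derivative f t) (at t)"
proof -
  define g where "g t = (if t \<in> {a..b} then f t else 0)" for t
  have "g integrable_on UNIV"
    unfolding g_def using f by (simp only: integrable_restrict_UNIV)
  then have g: "g integrable_on cbox c d" for c d
    by (rule integrable_on_subcbox) simp
  have g': "(\<lambda>t. g (- t)) integrable_on cbox c d" for c d
    using g[of "-d" "-c"] by (metis integrable_reflect minus_minus)
  obtain N1 where N1: "negligible N1"
    and R: "\<And>t e. t \<notin> N1 \<Longrightarrow> 0 < e \<Longrightarrow>
      \<exists>d>0. \<forall>h. 0 < h \<and> h < d \<longrightarrow> norm (integral (cbox t (t + h *\<^sub>R One)) g /\<^sub>R h ^ DIM(real) - g t) < e"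
    using integrable_ccontinuous_explicit[OF g] by metis
  obtain N2 where N2: "negligible N2"
    and L: "\<And>t e. t \<notin> N2 \<Longrightarrow> 0 < e \<Longrightarrow>
      \<exists>d>0. \<forall>h. 0 < h \<and> h < d \<longrightarrow>
        norm (integral (cbox t (t + h *\<^sub>R One)) (\<lambda>t. g (- t)) /\<^sub>R h ^ DIM(real) - g (- t)) < e"
    using integrable_ccontinuous_explicit[OF g'] by metis
  have "negligible (uminus ` N2)"
    by (rule negligible_differentiable_image_negligible[OF _ N2]) (auto simp: differentiable_on_def)
  with N1 have neg: "negligible (N1 \<union> uminus ` N2)" by (rule negligible_Un)
  have der: "((\<lambda>t. integral {a..t} f) has_vector_derivative f t) (at t)"
    if t: "t \<notin> N1 \<union> uminus ` N2" "a < t" "t < b" for t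
    unfolding has_vector_derivative_def has_derivative_at_alt
  proof (intro conjI allI impI)
    show "bounded_linear (\<lambda>h. h *\<^sub>R f t)" by (rule bounded_linear_scaleR_left)
    fix e :: real assume "e > 0"
    have gt: "g t = f t" using t by (simp add: g_def)
    have "t \<notin> N1" using t by auto
    from R[OF this \<open>e > 0\<close>] obtain d1 where d1: "d1 > 0" "\<And>h. 0 < h \<Longrightarrow> h < d1 \<Longrightarrow>
        norm (integral {t..t + h} g /\<^sub>R h - f t) < e"
      by (auto simp: gt)
    have "- t \<notin> N2" using t by force
    from L[OF this \<open>e > 0\<close>] obtain d2 where d2: "d2 > 0" "\<And>h. 0 < h \<Longrightarrow> h < d2 \<Longrightarrow>
        norm (integral {- t..- t + h} (\<lambda>t. g (- t)) /\<^sub>R h - f t) < e"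
      by (auto simp: gt)
    have scale: "norm (v - h *\<^sub>R f t) \<le> e * h" if "0 < h" "norm (v /\<^sub>R h - f t) < e" for v :: 'a and h
    proof -
      have "v - h *\<^sub>R f t = h *\<^sub>R (v /\<^sub>R h - f t)" using that by (simp add: algebra_simps)
      then show ?thesis using that by simp
    qed
    have gi: "integral {c..d} g = integral {c..d} f" if "a \<le> c" "d \<le> b" for c d
      by (rule integral_cong) (use that in \<open>auto simp: g_def\<close>)
    have combine: "integral {a..d} f - integral {a..c} f = integral {c..d} g" if "a \<le> c" "c \<le> d" "d \<le> b" for c d
      using Henstock_Kurzweil_Integration.integral_combine[OF that(1,2) integrable_subinterval_real[OF f]] that
      by (auto simp: gi algebra_simps)
    show "\<exists>d>0. \<forall>y. norm (y - t) < d \<longrightarrow>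
            norm (integral {a..y} f - integral {a..t} f - (y - t) *\<^sub>R f t) \<le> e * norm (y - t)"
    proof (intro exI[of _ "min (min d1 d2) (min (t - a) (b - t))"] conjI allI impI)
      show "0 < min (min d1 d2) (min (t - a) (b - t))" using d1 d2 t by auto
      fix y assume y: "norm (y - t) < min (min d1 d2) (min (t - a) (b - t))"
      consider "y = t" | "y > t" | "y < t" by linarith
      then show "norm (integral {a..y} f - integral {a..t} f - (y - t) *\<^sub>R f t) \<le> e * norm (y - t)"
      proof cases
        case 2
        then show ?thesis using scale[OF _ d1(2)[of "y - t"]] y t by (auto simp: combine)
      next
        case 3
        have "integral {- t..- y} (\<lambda>t. g (- t)) = integral {y..t} g"
          by (rule Henstock_Kurzweil_Integration.integral_reflect_real)
        moreover have "norm (integral {- t..- y} (\<lambda>t. g (- t)) - (t - y) *\<^sub>R f t) \<le> e * (t - y)"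
          using scale[OF _ d2(2)[of "t - y"]] y 3 by auto
        moreover have "integral {a..y} f - integral {a..t} f - (y - t) *\<^sub>R f t
            = - (integral {y..t} g - (t - y) *\<^sub>R f t)"
          using combine[of y t] 3 y t by (auto simp: algebra_simps)
        ultimately show ?thesis using 3 by (simp add: norm_minus_commute)
      qed simp
    qed
  qed
  show ?thesis
    by (rule AE_I'[of "N1 \<union> uminus ` N2"]) (use neg der in \<open>auto simp: negligible_iff_null_sets\<close>)
qed

text \<open>Open intervals are used for the cut-off integrands, since adjacent closed intervals share an
endpoint, where the sum of the cut-offs would exceed \<open>h\<close>.\<close>

lemma sum_integral_nonoverlapping_le:
  fixes h :: "real \<Rightarrow> real"
  assumes h: "h integrable_on {a..b}" "\<And>x. x \<in> {a..b} \<Longrightarrow> 0 \<le> h x"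
    and P: "finite P" "\<forall>(s, t)\<in>P. s \<le> t \<and> {s..t} \<subseteq> {a..b}"
    and disj: "pairwise (\<lambda>(s, t) (s', t'). {s<..<t} \<inter> {s'<..<t'} = {}) P"
  shows "(\<Sum>(s, t)\<in>P. integral {s..t} h) \<le> integral {a..b} h"
proof -
  let ?f = "\<lambda>p x. if x \<in> box (fst p) (snd p) then h x else 0"
  have hi: "(?f p has_integral integral {fst p..snd p} h) {a..b}" if "p \<in> P" for p
  proof -
    have sub: "{fst p..snd p} \<subseteq> {a..b}" using P(2) that by auto
    have "(h has_integral integral {fst p..snd p} h) {fst p..snd p}"
      using integrable_subinterval_real[OF h(1) sub] by blast
    then show ?thesis using has_integral_restrict_open_subinterval[of h _ "fst p" "snd p" a b] sub by simp
  qed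
  have sum_hi: "((\<lambda>x. \<Sum>p\<in>P. ?f p x) has_integral (\<Sum>p\<in>P. integral {fst p..snd p} h)) {a..b}"
    by (rule has_integral_sum[OF P(1) hi])
  have sum_le: "(\<Sum>p\<in>P. ?f p x) \<le> h x" if x: "x \<in> {a..b}" for x
  proof (cases "\<exists>p\<in>P. x \<in> box (fst p) (snd p)")
    case True
    then obtain p where p: "p \<in> P" "x \<in> box (fst p) (snd p)" by blast
    have "?f q x = 0" if "q \<in> P - {p}" for q
    proof -
      have "{fst q<..<snd q} \<inter> {fst p<..<snd p} = {}"
        using disj that p(1) unfolding pairwise_def by (force simp: case_prod_beta)
      then show ?thesis using p(2) by auto
    qed
    then have "(\<Sum>q\<in>P. ?f q x) = ?f p x"
      using sum.mono_neutral_right[of P "{p}" "\<lambda>q. ?f q x"] P(1) p(1) by auto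
    then show ?thesis using p by simp
  next
    case False
    then have "(\<Sum>p\<in>P. ?f p x) = 0" by (intro sum.neutral) auto
    then show ?thesis using h(2)[OF x] by simp
  qed
  have "(\<Sum>p\<in>P. integral {fst p..snd p} h) \<le> integral {a..b} h"
    by (rule has_integral_le[OF sum_hi integrable_integral[OF h(1)] sum_le])
  then show ?thesis by (simp add: case_prod_beta)
qed

text \<open>Truncating \<open>m\<close> at a large height \<open>k\<close> leaves an excess \<open>h\<close> with small integral. On short families of
intervals the truncated part contributes at most \<open>k\<close> times the total length, and the excess at most
its integral over \<open>[a, b]\<close>.\<close>

lemma absolutely_continuous_fun_onI:
  fixes x :: "real \<Rightarrow> 'a::euclidean_space"
  assumes m: "m integrable_on {a..b}" "\<And>s. s \<in> {a..b} \<Longrightarrow> 0 \<le> m s"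
    and bound: "\<And>s t. a \<le> s \<Longrightarrow> s \<le> t \<Longrightarrow> t \<le> b \<Longrightarrow> norm (x t - x s) \<le> integral {s..t} m"
  shows "absolutely_continuous_fun_on {a..b} x"
  unfolding absolutely_continuous_fun_on_def
proof (intro allI impI)
  fix e :: real assume e: "e > 0"
  define mk where "mk k s = min (m s) (real k)" for k s
  have m_abs: "m absolutely_integrable_on {a..b}"
    by (rule nonnegative_absolutely_integrable_1[OF m])
  have mk_int: "mk k integrable_on {a..b}" for k
    unfolding mk_def
    using absolutely_integrable_min_1[OF m_abs absolutely_integrable_on_const] 
      set_lebesgue_integral_eq_integral(1) by blast
  have "(\<lambda>k. integral {a..b} (mk k)) \<longlonglongrightarrow> integral {a..b} m"
  proof (rule dominated_convergence(2)[OF mk_int m(1)])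
    show "norm (mk k s) \<le> m s" if "s \<in> {a..b}" for k s
      using m(2)[OF that] by (simp add: mk_def)
    show "(\<lambda>k. mk k s) \<longlonglongrightarrow> m s" for s
    proof (rule tendsto_eventually)
      obtain K :: nat where "m s < K" using reals_Archimedean2 by blast
      then show "\<forall>\<^sub>F k in sequentially. mk k s = m s"
        by (intro eventually_sequentiallyI[of K]) (auto simp: mk_def)
    qed
  qed
  then have "\<forall>\<^sub>F k in sequentially. dist (integral {a..b} (mk k)) (integral {a..b} m) < e / 2"
    using e by (intro tendstoD) auto
  then obtain k where k: "dist (integral {a..b} (mk k)) (integral {a..b} m) < e / 2"
    unfolding eventually_sequentially by blast
  define h where "h s = m s - mk k s" for s
  have h: "h integrable_on {a..b}" unfolding h_def by (intro integrable_diff m mk_int)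
  have h_small: "integral {a..b} h < e / 2"
    using k Henstock_Kurzweil_Integration.integral_diff[OF m(1) mk_int[of k]]
    unfolding h_def dist_real_def by linarith
  show "\<exists>d>0. \<forall>P. finite P \<longrightarrow> (\<forall>(s, t)\<in>P. s \<le> t \<and> {s..t} \<subseteq> {a..b}) \<longrightarrow>
        pairwise (\<lambda>(s, t) (s', t'). {s<..<t} \<inter> {s'<..<t'} = {}) P \<longrightarrow>
        (\<Sum>(s, t)\<in>P. t - s) < d \<longrightarrow> (\<Sum>(s, t)\<in>P. norm (x t - x s)) < e"
  proof (intro exI[of _ "e / (2 * (real k + 1))"] conjI allI impI)
    show "0 < e / (2 * (real k + 1))" using e by simp
    fix P :: "(real \<times> real) set"
    assume P: "finite P" "\<forall>(s, t)\<in>P. s \<le> t \<and> {s..t} \<subseteq> {a..b}"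
      "pairwise (\<lambda>(s, t) (s', t'). {s<..<t} \<inter> {s'<..<t'} = {}) P"
      and small: "(\<Sum>(s, t)\<in>P. t - s) < e / (2 * (real k + 1))"
    have "norm (x t - x s) \<le> real k * (t - s) + integral {s..t} h" if st: "(s, t) \<in> P" for s t
    proof -
      have sub: "s \<le> t" "{s..t} \<subseteq> {a..b}" "a \<le> s" "t \<le> b" using P(2) st by auto
      have "norm (x t - x s) \<le> integral {s..t} m" using bound sub by blast
      also have "\<dots> = integral {s..t} (mk k) + integral {s..t} h"
        using Henstock_Kurzweil_Integration.integral_diff
          [OF integrable_subinterval_real[OF m(1) sub(2)] integrable_subinterval_real[OF mk_int[of k] sub(2)]]
        unfolding h_def by simp
      also have "integral {s..t} (mk k) \<le> integral {s..t} (\<lambda>_. real k)"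
        by (rule integral_le[OF integrable_subinterval_real[OF mk_int sub(2)]]) (auto simp: mk_def)
      finally show ?thesis using sub by (simp add: mult.commute)
    qed
    then have "(\<Sum>(s, t)\<in>P. norm (x t - x s)) \<le> (\<Sum>(s, t)\<in>P. real k * (t - s) + integral {s..t} h)"
      by (intro sum_mono) auto
    also have "\<dots> = real k * (\<Sum>(s, t)\<in>P. t - s) + (\<Sum>(s, t)\<in>P. integral {s..t} h)"
      by (simp add: case_prod_beta sum.distrib sum_distrib_left)
    also have "(\<Sum>(s, t)\<in>P. integral {s..t} h) \<le> integral {a..b} h"
      by (rule sum_integral_nonoverlapping_le[OF h _ P]) (simp add: h_def mk_def)
    also have "real k * (\<Sum>(s, t)\<in>P. t - s) \<le> real k * (e / (2 * (real k + 1)))"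
      using small by (intro mult_left_mono) auto
    also have "\<dots> \<le> e / 2" using e by (simp add: field_simps)
    finally show "(\<Sum>(s, t)\<in>P. norm (x t - x s)) < e" using h_small by linarith
  qed
qed

lemma T_periodic_add_int:
  assumes "T_periodic T f"
  shows "f (t + of_int k * T) = f t"
proof -
  have nat: "f (t + of_nat n * T) = f t" for t n
  proof (induction n)
    case (Suc n)
    have "f (t + of_nat (Suc n) * T) = f ((t + of_nat n * T) + T)" by (simp add: algebra_simps)
    then show ?case using Suc assms by (simp add: T_periodic_def)
  qed simp
  show ?thesis
  proof (cases "k \<ge> 0")
    case True
    then show ?thesis using nat[of t "nat k"] by (simp add: of_nat_nat)
  next
    case False
    then show ?thesis using nat[of "t + of_int k * T" "nat (- k)"] by (simp add: of_nat_nat)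
  qed
qed

lemma has_integral_T_periodic:
  fixes f :: "real \<Rightarrow> 'a::euclidean_space"
  assumes T: "T > 0" and per: "T_periodic T f" and f: "f integrable_on {0..T}"
  shows "(f has_integral integral {0..T} f) {a..a + T}"
proof -
  define k where "k = \<lfloor>a / T\<rfloor>"
  define s where "s = a - of_int k * T"
  have s: "0 \<le> s" "s \<le> T"
    using floor_divide_lower[OF T, of a] floor_divide_upper[OF T, of a]
    unfolding s_def k_def by (auto simp: algebra_simps)
  have shift: "(\<lambda>t. f (t + of_int j * T)) = f" for j
    using T_periodic_add_int[OF per] by auto
  have "(f has_integral integral {s..T} f) {s..T}"
    using integrable_subinterval_real[OF f] s by (intro integrable_integral) auto
  moreover have "(f has_integral integral {0..s} f) {T..s + T}"
    using has_integral_shift_real_ivl[of f "integral {0..s} f" 0 s "-T"] shift[of "-1"]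
      integrable_integral[OF integrable_subinterval_real[OF f, of 0 s]] s by auto
  ultimately have "(f has_integral integral {s..T} f + integral {0..s} f) {s..s + T}"
    by (rule has_integral_combine[rotated 2]) (use s in auto)
  then have "((\<lambda>t. f (t + of_int (- k) * T)) has_integral integral {0..T} f) {s - of_int (- k) * T..s + T - of_int (- k) * T}"
    using Henstock_Kurzweil_Integration.integral_combine[OF s f]
    by (intro has_integral_shift_real_ivl) (simp add: add.commute)
  moreover have "s - of_int (- k) * T = a" by (simp add: s_def)
  ultimately show ?thesis unfolding shift by (simp add: algebra_simps)
qed

section \<open>Matrices with a simple eigenvalue and linear systems\<close>

lemma bounded_bilinear_matrix_vector_mult:
  "bounded_bilinear ((*v) :: real^'n^'m \<Rightarrow> real^'n \<Rightarrow> real^'m)"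
  unfolding bilinear_conv_bounded_bilinear[symmetric] bilinear_def
  by (intro conjI allI linearI)
     (simp_all add: matrix_vector_mult_add_rdistrib matrix_vector_right_distrib
        matrix_vector_mult_def vec_eq_iff sum.distrib algebra_simps sum_distrib_left)

lemma continuous_on_det:
  fixes A :: "'a::topological_space \<Rightarrow> real^'n^'n"
  assumes "continuous_on S A"
  shows "continuous_on S (\<lambda>x. det (A x))"
  unfolding det_def by (intro continuous_intros assms)

lemma matrix_inv_cancel:
  fixes A :: "real^'n^'n"
  assumes "invertible A"
  shows "A *v (matrix_inv A *v v) = v"
proof -
  have "A ** matrix_inv A = mat 1 \<and> matrix_inv A ** A = mat 1"
    using assms unfolding invertible_def matrix_inv_def by (rule someI_ex)
  then show ?thesis by (simp add: matrix_vector_mul_assoc)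
qed

lemma mat_vector_mult: "mat x *v v = x *\<^sub>R (v :: real^'n)"
  by (simp add: vec_eq_iff matrix_vector_mult_def mat_def if_distrib[of "\<lambda>z. z * _"] cong: if_cong)

text \<open>By Cramer's rule the entries of the inverse are quotients of determinants.\<close>

lemma continuous_on_matrix_inv:
  fixes A :: "'a::topological_space \<Rightarrow> real^'n^'n"
  assumes A: "continuous_on S A" and inv: "\<And>x. x \<in> S \<Longrightarrow> invertible (A x)"
  shows "continuous_on S (\<lambda>x. matrix_inv (A x))"
proof -
  have entry: "matrix_inv (A x) $ i $ l
      = det (\<chi> r c. if c = i then axis l 1 $ r else A x $ r $ c) / det (A x)" if "x \<in> S" for x i l
  proof -
    have "A x *v (matrix_inv (A x) *v axis l 1) = axis l 1"
      by (rule matrix_inv_cancel[OF inv[OF that]])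
    then have "matrix_inv (A x) *v axis l 1
        = (\<chi> k. det (\<chi> r c. if c = k then axis l 1 $ r else A x $ r $ c) / det (A x))"
      using cramer[of "A x" "matrix_inv (A x) *v axis l 1" "axis l 1"] inv[OF that] invertible_det_nz by blast
    then show ?thesis by (simp add: vec_eq_iff matrix_vector_mul_component inner_axis)
  qed
  have "continuous_on S (\<lambda>x. \<chi> i l. det (\<chi> r c. if c = i then axis l 1 $ r else A x $ r $ c) / det (A x))"
  proof (intro continuous_on_vec_lambda continuous_on_divide continuous_on_det A)
    show "continuous_on S (\<lambda>x. if c = i then axis l 1 $ r else A x $ r $ c)" for i l r c
      using A by (cases "c = i") (auto intro!: continuous_intros)
    show "\<forall>x\<in>S. det (A x) \<noteq> 0"
      using inv invertible_det_nz by blast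
  qed
  then show ?thesis
    by (rule continuous_on_eq) (simp add: entry vec_eq_iff)
qed

lemma rank_one_mult:
  fixes a b :: "real^'n"
  shows "(\<chi> i j. a $ i * b $ j) *v v = (b \<bullet> v) *\<^sub>R a"
  by (simp add: vec_eq_iff matrix_vector_mul_component inner_vec_def sum_distrib_left algebra_simps)

text \<open>An orthogonal \<open>Q\<close> that takes a coordinate axis to the direction of \<open>a\<close> reduces the claim to a matrix that
differs from the identity in a single row, and the determinant of such a matrix is its diagonal entry
in that row.\<close>

lemma det_rank_one_update:
  fixes a b :: "real^'n"
  shows "det (mat 1 + (\<chi> i j. a $ i * b $ j)) = 1 + a \<bullet> b"
proof (cases "a = 0")
  case True
  then have "(\<chi> i j. a $ i * b $ j) = (0 :: real^'n^'n)" by (simp add: vec_eq_iff)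
  then show ?thesis using True by (metis add.right_neutral det_I inner_zero_left)
next
  case False
  have "norm (a /\<^sub>R norm a) = 1" using False by simp
  from orthogonal_matrix_exists_basis[OF this, of undefined]
  obtain k Q where Q: "orthogonal_matrix Q" "Q *v axis k 1 = a /\<^sub>R norm a" by blast
  define b' where "b' = transpose Q *v (norm a *\<^sub>R b)"
  define N :: "real^'n^'n" where "N = (\<chi> i j. if i = k then (axis k 1 + b') $ j else mat 1 $ i $ j)"
  have QQ: "Q ** transpose Q = mat 1" "transpose Q ** Q = mat 1"
    using Q(1) unfolding orthogonal_matrix_def by auto
  have "det N = det (transpose N)" by simp
  also have "transpose N = (\<chi> i j. if j = k then (mat 1 *v (axis k 1 + b')) $ i else (mat 1 :: real^'n^'n) $ i $ j)"
    unfolding matrix_vector_mul_lid by (auto simp: N_def transpose_def vec_eq_iff mat_def)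
  also have "det \<dots> = 1 + b' $ k"
    by (subst cramer_lemma) simp
  finally have detN: "det N = 1 + b' $ k" .
  have bk: "b' $ k = a \<bullet> b"
  proof -
    have "b' $ k = axis k 1 \<bullet> (transpose Q *v (norm a *\<^sub>R b))"
      by (simp add: b'_def inner_axis')
    also have "\<dots> = (Q *v axis k 1) \<bullet> (norm a *\<^sub>R b)"
      by (metis dot_lmul_matrix transpose_matrix_vector transpose_transpose)
    finally show ?thesis using False by (simp add: Q(2))
  qed
  have "mat 1 + (\<chi> i j. a $ i * b $ j) = Q ** N ** transpose Q"
  proof (subst matrix_eq, intro allI)
    fix v :: "real^'n"
    let ?w = "transpose Q *v v"
    have Qw: "Q *v ?w = v"
      by (simp only: matrix_vector_mul_assoc QQ matrix_vector_mul_lid)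
    have "N = mat 1 + (\<chi> i j. axis k 1 $ i * b' $ j)"
      by (auto simp: N_def vec_eq_iff axis_def mat_def)
    then have Nw: "N *v w = w + (b' \<bullet> w) *\<^sub>R axis k 1" for w
      by (simp add: matrix_vector_mult_add_rdistrib rank_one_mult)
    have "(Q ** N ** transpose Q) *v v = Q *v (N *v ?w)"
      by (simp only: matrix_vector_mul_assoc matrix_mul_assoc)
    also have "\<dots> = v + (b' \<bullet> ?w) *\<^sub>R (a /\<^sub>R norm a)"
      by (simp only: Nw matrix_vector_right_distrib matrix_vector_mult_scaleR Q(2) Qw)
    also have "b' \<bullet> ?w = norm a * (b \<bullet> v)"
    proof -
      have "b' \<bullet> ?w = (norm a *\<^sub>R b) \<bullet> (Q *v ?w)"
        unfolding b'_def by (metis dot_lmul_matrix transpose_matrix_vector transpose_transpose)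
      then show ?thesis unfolding Qw by simp
    qed
    finally show "(mat 1 + (\<chi> i j. a $ i * b $ j)) *v v = (Q ** N ** transpose Q) *v v"
      using False by (simp add: matrix_vector_mult_add_rdistrib rank_one_mult)
  qed
  then have "det (mat 1 + (\<chi> i j. a $ i * b $ j)) = det N * (det Q * det (transpose Q))"
    by (simp add: det_mul)
  also have "det Q * det (transpose Q) = 1" by (metis QQ(1) det_I det_mul)
  finally show ?thesis by (simp add: detN bk)
qed

lemma poly_characteristic_polynomial:
  "poly (characteristic_polynomial M) x = det (mat x - M)"
proof -
  have "poly (characteristic_polynomial M) x
      = (\<Sum>p\<in>{p. p permutes UNIV}. of_int (sign p) *
          (\<Prod>i\<in>UNIV. poly ((if i = p i then [:0, 1:] else 0) - [:M $ i $ p i:]) x))"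
    unfolding characteristic_polynomial_def det_def
    by (simp add: poly_sum poly_prod)
  also have "\<dots> = det (mat x - M)"
    unfolding det_def by (intro sum.cong prod.cong arg_cong2[where f = "(*)"]) (auto simp: mat_def)
  finally show ?thesis .
qed

lemma characteristic_polynomial_nonzero: "characteristic_polynomial M \<noteq> 0"
proof
  assume 0: "characteristic_polynomial M = 0"
  obtain C where C: "\<And>v. norm (M *v v) \<le> norm v * C"
    using bounded_linear.bounded[OF matrix_vector_mul_bounded_linear] by blast
  define x where "x = \<bar>C\<bar> + 1"
  have "v = 0" if "(mat x - M) *v v = 0" for v
  proof -
    have "M *v v = x *\<^sub>R v"
      using that by (simp add: matrix_vector_mult_diff_rdistrib mat_vector_mult)
    then have "x * norm v \<le> norm v * C" using C[of v] by (simp add: x_def)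
    then have "norm v * (\<bar>C\<bar> + 1 - C) \<le> 0" by (simp add: x_def algebra_simps)
    then show ?thesis
      by (smt (verit) mult_pos_pos norm_ge_zero zero_less_norm_iff)
  qed
  then have "invertible (mat x - M)"
    using matrix_left_invertible_ker invertible_left_inverse by blast
  then show False
    using 0 poly_characteristic_polynomial[of M x] invertible_det_nz by fastforce
qed

text \<open>Bordering removes the eigenvalue \<open>1\<close> exactly when it is simple. With \<open>p\<close> the characteristic polynomial
and \<open>R = e \<zeta>\<^sup>T\<close>, the equation \<open>M e = e\<close> gives, for \<open>x \<noteq> 1\<close>, the factorization
\<open>x I - M + R = (x I - M) (I + R / (x - 1))\<close>. Hence the determinant is \<open>p(x) (x - 1 + e \<bullet> \<zeta>) / (x - 1)\<close>,
which tends to \<open>p'(1) (e \<bullet> \<zeta>) \<noteq> 0\<close> as \<open>x \<rightarrow> 1\<close>.\<close>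

lemma bordered_monodromy_invertible:
  fixes M :: "real^'n^'n" and e \<zeta> :: "real^'n"
  assumes Me: "M *v e = e" and c: "e \<bullet> \<zeta> \<noteq> 0"
    and ord: "order 1 (characteristic_polynomial M) = 1"
  shows "invertible (mat 1 - M + (\<chi> i j. e $ i * \<zeta> $ j))"
proof -
  let ?R = "(\<chi> i j. e $ i * \<zeta> $ j) :: real^'n^'n"
  let ?p = "characteristic_polynomial M"
  obtain r where r: "?p = [:- 1, 1:] * r" "\<not> [:- 1, 1:] dvd r"
    using order_decomp[OF characteristic_polynomial_nonzero[of M], of 1] ord by auto
  have r1: "poly r 1 \<noteq> 0" using r(2) poly_eq_0_iff_dvd by blast
  have det_eq: "det (mat x - M + ?R) = poly r x * (x - 1 + e \<bullet> \<zeta>)" if x: "x \<noteq> 1" for x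
  proof -
    define a where "a = e /\<^sub>R (x - 1)"
    have "mat x - M + ?R = (mat x - M) ** (mat 1 + (\<chi> i j. a $ i * \<zeta> $ j))"
    proof (subst matrix_eq, intro allI)
      fix v :: "real^'n"
      have "(mat x - M) *v a = (x - 1) *\<^sub>R a"
      proof -
        have "M *v a = a" by (simp add: a_def matrix_vector_mult_scaleR Me)
        then show ?thesis by (simp add: matrix_vector_mult_diff_rdistrib mat_vector_mult scaleR_left_diff_distrib)
      qed
      then have "(mat x - M) *v a = e" using x by (simp add: a_def)
      then show "(mat x - M + ?R) *v v = ((mat x - M) ** (mat 1 + (\<chi> i j. a $ i * \<zeta> $ j))) *v v"
        by (simp add: matrix_vector_mult_add_rdistrib rank_one_mult matrix_vector_right_distrib
              matrix_vector_mult_scaleR flip: matrix_vector_mul_assoc)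
    qed
    then have "det (mat x - M + ?R) = poly ?p x * (1 + a \<bullet> \<zeta>)"
      by (simp add: det_mul det_rank_one_update poly_characteristic_polynomial)
    also have "\<dots> = poly r x * ((x - 1) * (1 + a \<bullet> \<zeta>))" by (simp add: r(1) algebra_simps)
    also have "(x - 1) * (1 + a \<bullet> \<zeta>) = x - 1 + e \<bullet> \<zeta>"
      using x by (simp add: a_def distrib_left)
    finally show ?thesis .
  qed
  have "(\<lambda>x. det (mat x - M + ?R)) = poly (characteristic_polynomial (M - ?R))"
    by (simp add: poly_characteristic_polynomial fun_eq_iff algebra_simps)
  then have "(\<lambda>x. det (mat x - M + ?R)) \<midarrow>1\<rightarrow> det (mat 1 - M + ?R)"
    using poly_isCont[of 1 "characteristic_polynomial (M - ?R)"] unfolding isCont_def by metis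
  moreover have "(\<lambda>x. det (mat x - M + ?R)) \<midarrow>1\<rightarrow> poly r 1 * (1 - 1 + e \<bullet> \<zeta>)"
  proof (rule Lim_transform_eventually)
    show "(\<lambda>x. poly r x * (x - 1 + e \<bullet> \<zeta>)) \<midarrow>1\<rightarrow> poly r 1 * (1 - 1 + e \<bullet> \<zeta>)"
      using poly_isCont[of 1 r] unfolding isCont_def by (intro tendsto_intros)
    show "\<forall>\<^sub>F x in at 1. poly r x * (x - 1 + e \<bullet> \<zeta>) = det (mat x - M + ?R)"
      by (auto simp: eventually_at det_eq intro: exI[of _ 1])
  qed
  ultimately have "det (mat 1 - M + ?R) = poly r 1 * (1 - 1 + e \<bullet> \<zeta>)"
    by (rule LIM_unique)
  then show ?thesis using r1 c by (simp add: invertible_det_nz)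
qed

text \<open>Put \<open>L = B\<^sup>-\<^sup>1 M\<close> for the bordered matrix \<open>B = I - M + e \<zeta>\<^sup>T\<close>. Pairing \<open>B v = M q\<close> with the left fixed vector
\<open>\<zeta>\<close> shows \<open>\<zeta> \<bullet> v = 0\<close>, so the bordering term drops out of the equation for \<open>v = L q\<close>.\<close>

lemma periodic_boundary_operator:
  fixes M :: "real^'n^'n" and e \<zeta> :: "real^'n"
  assumes Me: "M *v e = e" and M\<zeta>: "\<And>v. \<zeta> \<bullet> (M *v v) = \<zeta> \<bullet> v" and c: "e \<bullet> \<zeta> \<noteq> 0"
    and ord: "order 1 (characteristic_polynomial M) = 1"
  obtains L :: "real^'n^'n" where "\<And>q. \<zeta> \<bullet> q = 0 \<Longrightarrow> M *v (L *v q + q) = L *v q"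
proof -
  define R :: "real^'n^'n" where "R = (\<chi> i j. e $ i * \<zeta> $ j)"
  have inv: "invertible (mat 1 - M + R)"
    unfolding R_def by (rule bordered_monodromy_invertible[OF Me c ord])
  have Rv: "R *v v = (\<zeta> \<bullet> v) *\<^sub>R e" for v
    unfolding R_def by (rule rank_one_mult)
  define L where "L = matrix_inv (mat 1 - M + R) ** M"
  show thesis
  proof
    fix q assume q: "\<zeta> \<bullet> q = 0"
    let ?v = "L *v q"
    have "(mat 1 - M + R) *v ?v = M *v q"
      by (simp add: L_def matrix_inv_cancel[OF inv] flip: matrix_vector_mul_assoc)
    then have eq: "?v - M *v ?v + (\<zeta> \<bullet> ?v) *\<^sub>R e = M *v q"
      by (simp add: matrix_vector_mult_add_rdistrib matrix_vector_mult_diff_rdistrib Rv)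
    from arg_cong[OF this, of "\<lambda>w. \<zeta> \<bullet> w"] have "(\<zeta> \<bullet> ?v) * (\<zeta> \<bullet> e) = 0"
      by (simp add: inner_add_right inner_diff_right M\<zeta> q)
    then have "\<zeta> \<bullet> ?v = 0" using c by (simp add: inner_commute)
    then show "M *v (?v + q) = ?v"
      using eq by (simp add: matrix_vector_right_distrib algebra_simps)
  qed
qed

text \<open>Gronwall's argument in both time directions: \<open>|y|\<^sup>2 exp(-2 C t)\<close> is nonincreasing and \<open>|y|\<^sup>2 exp(2 C t)\<close> is
nondecreasing.\<close>

lemma linear_ode_solution_eq_0:
  fixes y :: "real \<Rightarrow> 'a::euclidean_space"
  assumes y: "\<And>t. (y has_vector_derivative A t (y t)) (at t)"
    and A: "\<And>t v. norm (A t v) \<le> C * norm v"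
    and y0: "y t0 = 0"
  shows "y t = 0"
proof -
  have ip: "\<bar>y s \<bullet> A s (y s)\<bar> \<le> C * (y s \<bullet> y s)" for s
  proof -
    have "\<bar>y s \<bullet> A s (y s)\<bar> \<le> norm (y s) * norm (A s (y s))" by (rule Cauchy_Schwarz_ineq2)
    also have "\<dots> \<le> norm (y s) * (C * norm (y s))" by (intro mult_left_mono A) auto
    finally show ?thesis by (simp add: dot_square_norm power2_eq_square mult_ac)
  qed
  have d: "((\<lambda>s. y s \<bullet> y s) has_real_derivative 2 * (y s \<bullet> A s (y s))) (at s)" for s
    using bounded_bilinear.has_vector_derivative[OF bounded_bilinear_inner y y, of s]
    by (simp add: has_real_derivative_iff_has_vector_derivative inner_commute)
  have dexp: "((\<lambda>s. (y s \<bullet> y s) * exp (k * s)) has_real_derivative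
      (2 * (y s \<bullet> A s (y s)) + k * (y s \<bullet> y s)) * exp (k * s)) (at s)" for k s
    by (auto intro!: derivative_eq_intros d simp: algebra_simps)
  consider "t0 \<le> t" | "t \<le> t0" by linarith
  then have "y t \<bullet> y t \<le> 0"
  proof cases
    case 1
    have "(y t \<bullet> y t) * exp (- 2 * C * t) \<le> (y t0 \<bullet> y t0) * exp (- 2 * C * t0)"
    proof (rule DERIV_nonpos_imp_nonincreasing[OF 1])
      show "\<exists>l. ((\<lambda>s. (y s \<bullet> y s) * exp (- 2 * C * s)) has_real_derivative l) (at s) \<and> l \<le> 0" for s
        using dexp[of "- 2 * C" s] ip[of s] by (intro exI conjI) (auto intro!: mult_nonpos_nonneg)
    qed
    then show ?thesis using y0 by (simp add: mult_le_0_iff)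
  next
    case 2
    have "(y t \<bullet> y t) * exp (2 * C * t) \<le> (y t0 \<bullet> y t0) * exp (2 * C * t0)"
    proof (rule DERIV_nonneg_imp_nondecreasing[OF 2])
      show "\<exists>l. ((\<lambda>s. (y s \<bullet> y s) * exp (2 * C * s)) has_real_derivative l) (at s) \<and> 0 \<le> l" for s
        using dexp[of "2 * C" s] ip[of s] by (intro exI conjI) (auto intro!: mult_nonneg_nonneg)
    qed
    then show ?thesis using y0 by (simp add: mult_le_0_iff)
  qed
  then show ?thesis by (simp add: inner_gt_zero_iff flip: not_less)
qed

section \<open>The linearization along a limit cycle\<close>

lemma C1_vector_field_has_derivative:
  assumes "C1_vector_field \<psi>"
  shows "(\<psi> has_derivative (\<lambda>h. jacobian \<psi> (at x) *v h)) (at x)"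
  using assms unfolding C1_vector_field_def by (simp add: jacobian_works)

text \<open>The linearization error is uniform over bounded sets of base points, by uniform continuity of the
Jacobian on a slightly larger ball and the mean value inequality.\<close>

lemma C1_uniform_linearization:
  fixes \<psi> :: "real^'n \<Rightarrow> real^'n"
  assumes C1: "C1_vector_field \<psi>" and e: "e > 0"
  obtains \<rho> where "\<rho> > 0"
    "\<And>x w. norm x \<le> r \<Longrightarrow> norm w \<le> \<rho> \<Longrightarrow>
       norm (\<psi> (x + w) - \<psi> x - jacobian \<psi> (at x) *v w) \<le> e * norm w"
proof -
  let ?J = "\<lambda>x. jacobian \<psi> (at x)"
  obtain K where K: "K > 0" "\<And>(A :: real^'n^'n) v. norm (A *v v) \<le> norm A * norm v * K"
    using bounded_bilinear.pos_bounded[OF bounded_bilinear_matrix_vector_mult] by blast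
  have "continuous_on (cball 0 (r + 1)) ?J"
    using C1 unfolding C1_vector_field_def by (auto intro: continuous_on_subset)
  then have "uniformly_continuous_on (cball 0 (r + 1)) ?J"
    by (rule compact_uniformly_continuous) simp
  moreover have "e / K > 0" using e K(1) by simp
  ultimately obtain d where d: "d > 0"
    "\<And>x y. x \<in> cball 0 (r + 1) \<Longrightarrow> y \<in> cball 0 (r + 1) \<Longrightarrow> dist y x < d \<Longrightarrow> dist (?J y) (?J x) < e / K"
    unfolding uniformly_continuous_on_def by metis
  show thesis
  proof
    show "min 1 (d / 2) > 0" using d(1) by simp
    fix x w :: "real^'n" assume x: "norm x \<le> r" and w: "norm w \<le> min 1 (d / 2)"
    have in_ball: "norm y \<le> r + 1" if "y \<in> cball x (norm w)" for y
    proof -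
      have "norm y \<le> norm x + norm (y - x)" by (metis add.commute norm_triangle_sub)
      then show ?thesis using that x w by (simp add: dist_norm norm_minus_commute)
    qed
    have "norm (\<psi> (x + w) - \<psi> x - ?J x *v (x + w - x)) \<le> norm (x + w - x) * e"
    proof (rule differentiable_bound_linearization[where S = "cball x (norm w)" and f' = "\<lambda>x h. ?J x *v h"])
      show "x + t *\<^sub>R (x + w - x) \<in> cball x (norm w)" if "t \<in> {0..1}" for t
        using that by (auto simp: dist_norm intro: mult_left_le_one_le)
      show "(\<psi> has_derivative (*v) (?J y)) (at y within cball x (norm w))" for y
        using C1_vector_field_has_derivative[OF C1] by (rule has_derivative_at_withinI)
      show "x \<in> cball x (norm w)" by simp
      fix y assume y: "y \<in> cball x (norm w)"
      show "onorm ((\<lambda>h. ?J y *v h) - (\<lambda>h. ?J x *v h)) \<le> e"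
      proof (rule onorm_le)
        fix v
        have "dist y x < d" using y w d(1) by (simp add: dist_commute)
        then have "norm (?J y - ?J x) < e / K"
          using d(2)[of x y] in_ball[OF y] in_ball[of x] by (simp add: dist_norm)
        then have small: "norm (?J y - ?J x) * K \<le> e" using K(1) by (simp add: field_simps)
        have "norm ((?J y - ?J x) *v v) \<le> (norm (?J y - ?J x) * K) * norm v"
          using K(2)[of "?J y - ?J x" v] by (simp add: mult_ac)
        also have "\<dots> \<le> e * norm v" using small by (rule mult_right_mono) simp
        finally show "norm (((\<lambda>h. ?J y *v h) - (\<lambda>h. ?J x *v h)) v) \<le> e * norm v"
          by (simp add: matrix_vector_mult_diff_rdistrib)
      qed
    qed
    then show "norm (\<psi> (x + w) - \<psi> x - ?J x *v w) \<le> e * norm w" by (simp add: mult.commute)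
  qed
qed

lemma compact_continuous_matrix_bound:
  fixes A :: "'a::topological_space \<Rightarrow> real^'n^'m"
  assumes "compact S" "continuous_on S A"
  obtains C where "C > 0" "\<And>x v. x \<in> S \<Longrightarrow> norm (A x *v v) \<le> C * norm v"
proof -
  obtain K where K: "K > 0" "\<And>(A :: real^'n^'m) v. norm (A *v v) \<le> norm A * norm v * K"
    using bounded_bilinear.pos_bounded[OF bounded_bilinear_matrix_vector_mult] by blast
  obtain b where b: "b > 0" "\<And>x. x \<in> S \<Longrightarrow> norm (A x) \<le> b"
    using compact_imp_bounded[OF compact_continuous_image[OF assms(2,1)]]
    unfolding bounded_pos by blast
  show thesis
  proof
    show "b * K > 0" using b K by simp
    fix x and v :: "real^'n" assume "x \<in> S"
    then have "norm (A x) * norm v * K \<le> b * norm v * K"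
      using b K(1) by (intro mult_right_mono) auto
    then show "norm (A x *v v) \<le> b * K * norm v" using K(2)[of "A x" v] by (simp add: mult_ac)
  qed
qed

lemma T_periodic_range:
  assumes "T > 0" "T_periodic T f"
  shows "range f = f ` {0..T}"
proof -
  have "f t \<in> f ` {0..T}" for t
  proof (rule image_eqI)
    show "f t = f (t + of_int (- \<lfloor>t / T\<rfloor>) * T)" by (rule T_periodic_add_int[OF assms(2), symmetric])
    show "t + of_int (- \<lfloor>t / T\<rfloor>) * T \<in> {0..T}"
      using floor_divide_lower[OF assms(1), of t] floor_divide_upper[OF assms(1), of t]
      by (auto simp: algebra_simps)
  qed
  then show ?thesis by auto
qed

lemma has_vector_derivative_imp_continuous_on:
  assumes "\<And>t. (f has_vector_derivative f' t) (at t)"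
  shows "continuous_on S f"
  by (intro continuous_at_imp_continuous_on ballI) (rule has_vector_derivative_continuous[OF assms])

lemma has_vector_derivative_translate:
  assumes "(f has_vector_derivative f') (at (t + c))"
  shows "((\<lambda>t. f (t + c)) has_vector_derivative f') (at t)"
proof -
  have "((\<lambda>t. t + c) has_vector_derivative 1) (at t)"
    by (auto intro!: derivative_eq_intros)
  from vector_diff_chain_at[OF this assms] show ?thesis by (simp add: o_def)
qed

locale limit_cycle =
  fixes T :: real and \<psi> :: "real^'n \<Rightarrow> real^'n" and x0 z0 :: "real \<Rightarrow> real^'n"
    and Y :: "real \<Rightarrow> real^'n^'n"
  assumes T_pos: "T > 0"
    and C1: "C1_vector_field \<psi>"
    and x0_sol: "classical_periodic_solution T (\<lambda>t x. \<psi> x) x0"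
    and Y_0: "Y 0 = mat 1"
    and Y_deriv: "\<And>t. (Y has_vector_derivative (jacobian \<psi> (at (x0 t)) ** Y t)) (at t)"
    and simple_multiplier: "order 1 (characteristic_polynomial (Y T)) = 1"
    and z0_sol: "classical_periodic_solution T
       (\<lambda>t z. - (transpose (jacobian \<psi> (at (x0 t))) *v z)) z0"
    and transversal: "\<psi> (x0 0) \<bullet> z0 0 \<noteq> 0"
begin

abbreviation J :: "real \<Rightarrow> real^'n^'n" where "J t \<equiv> jacobian \<psi> (at (x0 t))"

definition V :: "real \<Rightarrow> real^'n^'n" where "V t = matrix_inv (Y t)"

lemma x0_periodic: "T_periodic T x0"
  and x0_deriv: "(x0 has_vector_derivative \<psi> (x0 t)) (at t)"
  and z0_periodic: "T_periodic T z0"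
  and z0_deriv: "(z0 has_vector_derivative - (transpose (J t) *v z0 t)) (at t)"
  using x0_sol z0_sol unfolding classical_periodic_solution_def by blast+

lemma x0_cont: "continuous_on S x0"
  by (rule has_vector_derivative_imp_continuous_on[OF x0_deriv])

lemma z0_cont: "continuous_on S z0"
  by (rule has_vector_derivative_imp_continuous_on[OF z0_deriv])

lemma Y_cont: "continuous_on S Y"
  by (rule has_vector_derivative_imp_continuous_on[OF Y_deriv])

lemma \<psi>_cont: "continuous_on S \<psi>"
  by (intro continuous_at_imp_continuous_on ballI)
     (rule has_derivative_continuous[OF C1_vector_field_has_derivative[OF C1]])

lemma J_cont: "continuous_on S J"
  using C1 unfolding C1_vector_field_def
  by (intro continuous_on_compose2[OF _ x0_cont, of UNIV]) auto

lemma bounded_range_x0: "bounded (range x0)"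
  unfolding T_periodic_range[OF T_pos x0_periodic]
  by (intro compact_imp_bounded compact_continuous_image x0_cont) simp

lemma J_bound:
  obtains C where "C > 0" "\<And>t v. norm (J t *v v) \<le> C * norm v"
proof -
  obtain C where C: "C > 0" "\<And>t v. t \<in> {0..T} \<Longrightarrow> norm (J t *v v) \<le> C * norm v"
    using compact_continuous_matrix_bound[OF _ J_cont[of "{0..T}"]] by (metis compact_Icc)
  have "norm (J t *v v) \<le> C * norm v" for t v
  proof -
    have "x0 t \<in> x0 ` {0..T}" using T_periodic_range[OF T_pos x0_periodic] by blast
    then show ?thesis using C(2) by auto
  qed
  with C(1) show thesis by (rule that)
qed

lemma Y_vec_deriv: "((\<lambda>t. Y t *v c) has_vector_derivative J t *v (Y t *v c)) (at t)"
proof -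
  have "((\<lambda>t. Y t *v c) has_vector_derivative (J t ** Y t) *v c) (at t)"
    by (rule bounded_linear.has_vector_derivative
        [OF bounded_bilinear.bounded_linear_left[OF bounded_bilinear_matrix_vector_mult] Y_deriv])
  then show ?thesis by (simp add: matrix_vector_mul_assoc)
qed

text \<open>Uniqueness for the variational equation is the source of the invertibility of \<open>Y\<close>, of
\<open>Y(t + T) = Y(t) Y(T)\<close>, and of the fact that \<open>Y\<close> transports the velocity \<open>\<psi>(x\<^sub>0(0))\<close> along the cycle.\<close>

lemma variational_solution_unique:
  assumes "\<And>t. (y has_vector_derivative J t *v y t) (at t)"
  shows "y t = Y t *v y 0"
proof -
  obtain C where C: "\<And>t v. norm (J t *v v) \<le> C * norm v" using J_bound by blast
  have "((\<lambda>t. y t - Y t *v y 0) has_vector_derivative J t *v (y t - Y t *v y 0)) (at t)" for t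
    using has_vector_derivative_diff[OF assms Y_vec_deriv] by (simp add: matrix_vector_mult_diff_distrib)
  from linear_ode_solution_eq_0[OF this C, of 0 t] have "y t - Y t *v y 0 = 0"
    by (simp add: Y_0)
  then show ?thesis by simp
qed

lemma Y_invertible: "invertible (Y t)"
proof -
  obtain C where C: "\<And>t v. norm (J t *v v) \<le> C * norm v" using J_bound by blast
  have "c = 0" if "Y t *v c = 0" for c
    using linear_ode_solution_eq_0[OF Y_vec_deriv C that, of 0] by (simp add: Y_0)
  then show ?thesis
    using matrix_left_invertible_ker invertible_left_inverse by blast
qed

lemma Y_V: "Y t *v (V t *v v) = v"
  unfolding V_def by (rule matrix_inv_cancel[OF Y_invertible])

lemma V_cont: "continuous_on S V"
  unfolding V_def by (intro continuous_on_matrix_inv Y_cont Y_invertible)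

lemma Y_add_T: "Y (t + T) *v c = Y t *v (Y T *v c)"
proof -
  have "((\<lambda>t. Y (t + T) *v c) has_vector_derivative J t *v (Y (t + T) *v c)) (at t)" for t
    using has_vector_derivative_translate[OF Y_vec_deriv[of c "t + T"]] x0_periodic
    by (simp add: T_periodic_def)
  from variational_solution_unique[OF this, of t] show ?thesis by simp
qed

lemma velocity_eq: "\<psi> (x0 t) = Y t *v \<psi> (x0 0)"
proof (rule variational_solution_unique)
  fix t
  show "((\<lambda>t. \<psi> (x0 t)) has_vector_derivative J t *v \<psi> (x0 t)) (at t)"
    using vector_derivative_diff_chain_within[OF x0_deriv has_derivative_at_withinI[OF C1_vector_field_has_derivative[OF C1]]]
    by (simp add: o_def)
qed

lemma monodromy_velocity: "Y T *v \<psi> (x0 0) = \<psi> (x0 0)"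
  using velocity_eq[of T] x0_periodic by (metis T_periodic_def add_0)

text \<open>Solutions of the variational and of the adjoint equation have constant inner product. At \<open>t = T\<close> this
says that \<open>z\<^sub>0(0)\<close> is a left fixed vector of the monodromy matrix, and for general \<open>t\<close> it identifies
the functional \<open>z\<^sub>0(0) \<bullet> V(t) h\<close> with \<open>z\<^sub>0(t) \<bullet> h\<close>.\<close>

lemma adjoint_pairing: "z0 t \<bullet> (Y t *v c) = z0 0 \<bullet> c"
proof -
  have "((\<lambda>t. z0 t \<bullet> (Y t *v c)) has_vector_derivative 0) (at t)" for t
  proof -
    have "(transpose (J t) *v z0 t) \<bullet> (Y t *v c) = z0 t \<bullet> (J t *v (Y t *v c))"
      by (simp add: dot_lmul_matrix)
    moreover have "((\<lambda>t. z0 t \<bullet> (Y t *v c)) has_vector_derivative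
        z0 t \<bullet> (J t *v (Y t *v c)) + - (transpose (J t) *v z0 t) \<bullet> (Y t *v c)) (at t)"
      by (rule bounded_bilinear.has_vector_derivative[OF bounded_bilinear_inner z0_deriv Y_vec_deriv])
    ultimately show ?thesis by simp
  qed
  then obtain k where "\<And>t. t \<in> UNIV \<Longrightarrow> z0 t \<bullet> (Y t *v c) = k"
    using has_vector_derivative_zero_constant[of UNIV "\<lambda>t. z0 t \<bullet> (Y t *v c)"] by (metis convex_UNIV)
  then have "z0 t \<bullet> (Y t *v c) = z0 0 \<bullet> (Y 0 *v c)" by simp
  then show ?thesis by (simp add: Y_0)
qed

lemma adjoint_V: "z0 0 \<bullet> (V t *v h) = z0 t \<bullet> h"
  using adjoint_pairing[of t "V t *v h"] by (simp add: Y_V)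

lemma adjoint_monodromy: "z0 0 \<bullet> (Y T *v c) = z0 0 \<bullet> c"
  using adjoint_pairing[of T c] z0_periodic by (metis T_periodic_def add_0)

lemma boundary_operator:
  obtains L :: "real^'n^'n"
  where "\<And>q. z0 0 \<bullet> q = 0 \<Longrightarrow> Y T *v (L *v q + q) = L *v q"
  using periodic_boundary_operator[OF monodromy_velocity adjoint_monodromy transversal simple_multiplier]
  by blast

end

section \<open>The perturbed system in moving coordinates\<close>

text \<open>Setting \<open>\<phi>\<close> to zero on one null set makes continuity and domination hold at every time. This changes
neither the notion of a Caratheodory solution nor any of the integrals involved.\<close>

lemma caratheodory_perturbation_regularize:
  fixes \<phi> :: "real \<Rightarrow> real^'n \<Rightarrow> real \<Rightarrow> real^'n"
  assumes \<phi>: "caratheodory_perturbation T \<phi>" and r: "r > 0"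
  obtains \<Phi> b N where "negligible N" "\<And>t x \<epsilon>. t \<notin> N \<Longrightarrow> \<Phi> t x \<epsilon> = \<phi> t x \<epsilon>"
    "\<And>x \<epsilon>. \<epsilon> \<in> {0..1} \<Longrightarrow> (\<lambda>t. \<Phi> t x \<epsilon>) \<in> borel_measurable (lebesgue_on {0..T})"
    "\<And>t. continuous_on (UNIV \<times> {0..1}) (\<lambda>(x, \<epsilon>). \<Phi> t x \<epsilon>)"
    "b integrable_on {0..T}" "\<And>t. t \<in> {0..T} \<Longrightarrow> 0 \<le> b t"
    "\<And>t x \<epsilon>. t \<in> {0..T} \<Longrightarrow> norm x \<le> r \<Longrightarrow> \<epsilon> \<in> {0..1} \<Longrightarrow> norm (\<Phi> t x \<epsilon>) \<le> b t"
proof -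
  note parts = \<phi>[unfolded caratheodory_perturbation_def]
  obtain b where b: "set_integrable lebesgue {0..T} b" "\<forall>t\<in>{0..T}. 0 \<le> b t"
    and ae: "AE t in lebesgue. t \<in> {0..T} \<longrightarrow>
           (\<forall>x. \<forall>\<epsilon>\<in>{0..1}. norm x \<le> r \<longrightarrow> norm (\<phi> t x \<epsilon>) \<le> b t)"
    using parts[THEN conjunct2, THEN conjunct2, THEN conjunct2, THEN spec[of _ r], THEN mp, OF r] by (elim exE conjE)
  have "AE t in lebesgue. continuous_on (UNIV \<times> {0..1}) (\<lambda>(x, \<epsilon>). \<phi> t x \<epsilon>) \<and>
      (t \<in> {0..T} \<longrightarrow> (\<forall>x. \<forall>\<epsilon>\<in>{0..1}. norm x \<le> r \<longrightarrow> norm (\<phi> t x \<epsilon>) \<le> b t))"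
    using parts[THEN conjunct2, THEN conjunct2, THEN conjunct1] ae by (rule AE_conjI)
  then have N': "{t \<in> space lebesgue. \<not> (continuous_on (UNIV \<times> {0..1}) (\<lambda>(x, \<epsilon>). \<phi> t x \<epsilon>) \<and>
      (t \<in> {0..T} \<longrightarrow> (\<forall>x. \<forall>\<epsilon>\<in>{0..1}. norm x \<le> r \<longrightarrow> norm (\<phi> t x \<epsilon>) \<le> b t)))} \<in> null_sets lebesgue"
    (is "?N \<in> _") unfolding completion.AE_iff_null_sets .
  define N where "N = ?N"
  have N: "N \<in> null_sets lebesgue" using N' unfolding N_def .
  have good: "continuous_on (UNIV \<times> {0..1}) (\<lambda>(x, \<epsilon>). \<phi> t x \<epsilon>)"
      "t \<in> {0..T} \<Longrightarrow> \<epsilon> \<in> {0..1} \<Longrightarrow> norm x \<le> r \<Longrightarrow> norm (\<phi> t x \<epsilon>) \<le> b t"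
    if "t \<notin> N" for t x \<epsilon>
    using that unfolding N_def by simp_all
  define \<Phi> where "\<Phi> t x \<epsilon> = (if t \<in> N then 0 else \<phi> t x \<epsilon>)" for t x \<epsilon>
  show thesis
  proof
    show "negligible N" using N by (simp add: negligible_iff_null_sets)
    show "\<Phi> t x \<epsilon> = \<phi> t x \<epsilon>" if "t \<notin> N" for t x \<epsilon> using that by (simp add: \<Phi>_def)
    show "(\<lambda>t. \<Phi> t x \<epsilon>) \<in> borel_measurable (lebesgue_on {0..T})" if "\<epsilon> \<in> {0..1}" for x \<epsilon>
    proof -
      have "(\<lambda>t. \<phi> t x \<epsilon>) \<in> borel_measurable lebesgue"
        using parts[THEN conjunct2, THEN conjunct1] that by simp
      moreover have "AE t in lebesgue. \<phi> t x \<epsilon> = \<Phi> t x \<epsilon>"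
        by (rule AE_I'[OF N]) (auto simp: \<Phi>_def)
      ultimately have "(\<lambda>t. \<Phi> t x \<epsilon>) \<in> borel_measurable lebesgue"
        by (rule borel_measurable_AE)
      then show ?thesis by (rule measurable_restrict_space1)
    qed
    show "continuous_on (UNIV \<times> {0..1}) (\<lambda>(x, \<epsilon>). \<Phi> t x \<epsilon>)" for t
      using good(1)[of t] by (cases "t \<in> N") (auto simp: \<Phi>_def)
    show "b integrable_on {0..T}" using b(1) by (rule set_lebesgue_integral_eq_integral(1))
    show "0 \<le> b t" if "t \<in> {0..T}" for t using b(2) that by (rule bspec)
    show "norm (\<Phi> t x \<epsilon>) \<le> b t" if "t \<in> {0..T}" "norm x \<le> r" "\<epsilon> \<in> {0..1}" for t x \<epsilon>
      using good(2)[OF _ that(1,3,2)] bspec[OF b(2) that(1)] by (auto simp: \<Phi>_def)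
  qed
qed

lemma borel_measurable_continuous_lebesgue_on:
  fixes f :: "real \<Rightarrow> 'a::euclidean_space"
  shows "continuous_on {a..b} f \<Longrightarrow> f \<in> borel_measurable (lebesgue_on {a..b})"
  by (rule continuous_imp_measurable_on_sets_lebesgue) auto

text \<open>\<open>\<Phi>\<close> is a perturbation after its modification on a null set. The radius \<open>r + 1\<close> leaves room for a tube of width \<open>1\<close>
around the cycle, in which all solutions considered here stay.\<close>

locale perturbed_limit_cycle = limit_cycle T \<psi> x0 z0 Y
  for T :: real and \<psi> :: "real^'n \<Rightarrow> real^'n" and x0 z0 :: "real \<Rightarrow> real^'n"
    and Y :: "real \<Rightarrow> real^'n^'n" +
  fixes \<Phi> :: "real \<Rightarrow> real^'n \<Rightarrow> real \<Rightarrow> real^'n" and b :: "real \<Rightarrow> real" and r :: real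
  assumes x0_le: "\<And>t. norm (x0 t) \<le> r"
    and \<Phi>_meas: "\<And>x \<epsilon>. \<epsilon> \<in> {0..1} \<Longrightarrow> (\<lambda>t. \<Phi> t x \<epsilon>) \<in> borel_measurable (lebesgue_on {0..T})"
    and \<Phi>_cont: "\<And>t. continuous_on (UNIV \<times> {0..1}) (\<lambda>(x, \<epsilon>). \<Phi> t x \<epsilon>)"
    and b_int: "b integrable_on {0..T}" and b_nonneg: "\<And>t. t \<in> {0..T} \<Longrightarrow> 0 \<le> b t"
    and \<Phi>_bound: "\<And>t x \<epsilon>. t \<in> {0..T} \<Longrightarrow> norm x \<le> r + 1 \<Longrightarrow> \<epsilon> \<in> {0..1} \<Longrightarrow> norm (\<Phi> t x \<epsilon>) \<le> b t"
begin

definition remainder :: "real \<Rightarrow> real^'n \<Rightarrow> real^'n" where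
  "remainder \<tau> w = \<psi> (x0 \<tau> + w) - \<psi> (x0 \<tau>) - J \<tau> *v w"

definition force :: "real \<Rightarrow> real \<Rightarrow> real \<Rightarrow> real^'n \<Rightarrow> real^'n" where
  "force \<epsilon> t \<theta> w = remainder (t + \<theta>) w + \<epsilon> *\<^sub>R \<Phi> t (x0 (t + \<theta>) + w) \<epsilon>"

text \<open>The right-hand side of the equation for \<open>u\<close> in \<open>x(t) = x\<^sub>0(t + \<theta>) + Y(t + \<theta>) u(t)\<close>. The phase and the
value of \<open>u\<close> are paired so that joint continuity can be stated.\<close>

definition drift :: "real \<Rightarrow> real \<Rightarrow> real \<times> (real^'n) \<Rightarrow> real^'n" where
  "drift \<epsilon> t p = V (t + fst p) *v force \<epsilon> t (fst p) (Y (t + fst p) *v snd p)"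

text \<open>The Malkin function without its sign factor, with the time shift moved from \<open>\<phi>\<close> to the cycle.\<close>

definition bifurcation :: "real \<Rightarrow> real" where
  "bifurcation \<theta> = integral {0..T} (\<lambda>t. z0 (t + \<theta>) \<bullet> \<Phi> t (x0 (t + \<theta>)) 0)"

lemma \<Phi>_cont_compose:
  assumes "continuous_on S f" "\<epsilon> \<in> {0..1}"
  shows "continuous_on S (\<lambda>p. \<Phi> t (f p) \<epsilon>)"
proof -
  have "(\<lambda>p. (f p, \<epsilon>)) ` S \<subseteq> UNIV \<times> {0..1}" using assms(2) by auto
  from continuous_on_compose2[OF \<Phi>_cont[of t] continuous_on_Pair[OF assms(1) continuous_on_const] this]
  show ?thesis by simp
qed

lemma \<Phi>_superposition:
  assumes "continuous_on {0..T} y" "\<epsilon> \<in> {0..1}"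
  shows "(\<lambda>t. \<Phi> t (y t) \<epsilon>) \<in> borel_measurable (lebesgue_on {0..T})"
  by (rule borel_measurable_superposition[where F = "\<lambda>t x. \<Phi> t x \<epsilon>"])
     (rule \<Phi>_meas[OF assms(2)] \<Phi>_cont_compose[OF continuous_on_id assms(2)]
        borel_measurable_continuous_lebesgue_on[OF assms(1)])+

lemmas continuous_on_matrix_vector =
  bounded_bilinear.continuous_on[OF bounded_bilinear_matrix_vector_mult]

lemma cycle_continuous_compose:
  assumes "continuous_on S f"
  shows "continuous_on S (\<lambda>p. x0 (f p))" "continuous_on S (\<lambda>p. z0 (f p))"
    "continuous_on S (\<lambda>p. Y (f p))" "continuous_on S (\<lambda>p. V (f p))" "continuous_on S (\<lambda>p. J (f p))"
  by (rule continuous_on_compose2[OF _ assms subset_UNIV], rule x0_cont z0_cont Y_cont V_cont J_cont)+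

lemma remainder_continuous:
  assumes "continuous_on S f" "continuous_on S g"
  shows "continuous_on S (\<lambda>p. remainder (f p) (g p))"
proof -
  have \<psi>: "continuous_on S (\<lambda>p. \<psi> (h p))" if "continuous_on S h" for h
    by (rule continuous_on_compose2[OF \<psi>_cont that subset_UNIV])
  show ?thesis
    unfolding remainder_def
    by (intro continuous_on_diff \<psi> continuous_on_add continuous_on_matrix_vector cycle_continuous_compose assms)
qed

lemma drift_continuous:
  assumes "\<epsilon> \<in> {0..1}"
  shows "continuous_on UNIV (drift \<epsilon> t)"
  unfolding drift_def[abs_def] force_def
  by (intro continuous_on_matrix_vector cycle_continuous_compose continuous_on_add remainder_continuous
      continuous_on_scaleR \<Phi>_cont_compose continuous_intros assms)

lemma force_measurable:
  assumes "\<epsilon> \<in> {0..1}" "continuous_on {0..T} u"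
  shows "(\<lambda>t. force \<epsilon> t \<theta> (u t)) \<in> borel_measurable (lebesgue_on {0..T})"
  unfolding force_def
  by (intro borel_measurable_add borel_measurable_scaleR borel_measurable_const \<Phi>_superposition
      borel_measurable_continuous_lebesgue_on remainder_continuous continuous_on_add
      cycle_continuous_compose continuous_intros assms)

lemma drift_measurable:
  assumes "\<epsilon> \<in> {0..1}" "continuous_on {0..T} u"
  shows "(\<lambda>t. drift \<epsilon> t (\<theta>, u t)) \<in> borel_measurable (lebesgue_on {0..T})"
  unfolding drift_def fst_conv snd_conv
  by (intro borel_measurable_bilinear[OF bilinear_conv_bounded_bilinear[THEN iffD2, OF bounded_bilinear_matrix_vector_mult]]
      force_measurable borel_measurable_continuous_lebesgue_on continuous_on_matrix_vector
      cycle_continuous_compose continuous_intros assms) auto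

lemma remainder_small:
  assumes "e > 0"
  obtains \<rho> where "\<rho> > 0" "\<And>\<tau> w. norm w \<le> \<rho> \<Longrightarrow> norm (remainder \<tau> w) \<le> e * norm w"
  using C1_uniform_linearization[OF C1 assms, of r] x0_le unfolding remainder_def by metis

lemma adjoint_drift: "z0 0 \<bullet> drift \<epsilon> t (\<theta>, u) = z0 (t + \<theta>) \<bullet> force \<epsilon> t \<theta> (Y (t + \<theta>) *v u)"
  by (simp add: drift_def adjoint_V)

lemma force_bound:
  assumes "t \<in> {0..T}" "\<epsilon> \<in> {0..1}" "norm w \<le> 1" "norm (remainder (t + \<theta>) w) \<le> e"
  shows "norm (force \<epsilon> t \<theta> w) \<le> e + \<epsilon> * b t"
proof -
  have "norm (x0 (t + \<theta>) + w) \<le> r + 1"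
    using norm_triangle_ineq[of "x0 (t + \<theta>)" w] x0_le[of "t + \<theta>"] assms(3) by linarith
  then have "norm (\<Phi> t (x0 (t + \<theta>) + w) \<epsilon>) \<le> b t" using \<Phi>_bound assms by blast
  then have "norm (\<epsilon> *\<^sub>R \<Phi> t (x0 (t + \<theta>) + w) \<epsilon>) \<le> \<epsilon> * b t"
    using assms(2) by (auto intro: mult_left_mono)
  then show ?thesis
    unfolding force_def using norm_triangle_ineq assms(4) by (smt (verit))
qed

text \<open>The first-order expansion in \<open>\<epsilon>\<close> of the solvability condition. For \<open>u = O(\<epsilon>)\<close> the remainder is \<open>o(\<epsilon>)\<close>,
so after division by \<open>\<epsilon>\<close> only the perturbation along the unperturbed cycle survives; the integrands
are dominated by a constant plus a multiple of \<open>b\<close>.\<close>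

lemma scaled_boundary_integral_tendsto:
  fixes u :: "nat \<Rightarrow> real \<Rightarrow> real^'n" and \<epsilon> :: "nat \<Rightarrow> real"
  assumes CY: "CY > 0" "\<And>t v. t \<in> {0..T} \<Longrightarrow> norm (Y (t + \<theta>) *v v) \<le> CY * norm v"
    and \<rho>: "\<And>\<tau> w. norm w \<le> \<rho> \<Longrightarrow> norm (remainder \<tau> w) \<le> norm w"
    and \<epsilon>: "\<And>k. 0 < \<epsilon> k" "\<And>k. \<epsilon> k \<le> 1" "\<And>k. CY * (K * \<epsilon> k) \<le> min 1 \<rho>" "\<epsilon> \<longlonglongrightarrow> 0"
    and u: "\<And>k. continuous_on {0..T} (u k)" "\<And>k t. t \<in> {0..T} \<Longrightarrow> norm (u k t) \<le> K * \<epsilon> k"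
  shows "(\<lambda>k. (z0 0 \<bullet> integral {0..T} (\<lambda>t. drift (\<epsilon> k) t (\<theta>, u k t))) / \<epsilon> k) \<longlonglongrightarrow> bifurcation \<theta>"
proof -
  define w where "w k t = Y (t + \<theta>) *v u k t" for k t
  have \<epsilon>01: "\<epsilon> k \<in> {0..1}" for k using \<epsilon>(1,2)[of k] by auto
  have w_le: "norm (w k t) \<le> CY * (K * \<epsilon> k)" if "t \<in> {0..T}" for k t
    using CY(2)[OF that, of "u k t"] mult_left_mono[OF u(2)[OF that, of k] less_imp_le[OF CY(1)]]
    by (simp add: w_def)
  have w_lim: "(\<lambda>k. w k t) \<longlonglongrightarrow> 0" if "t \<in> {0..T}" for t
  proof (rule Lim_null_comparison)
    show "\<forall>\<^sub>F k in sequentially. norm (w k t) \<le> CY * (K * \<epsilon> k)" using w_le[OF that] by simp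
    show "(\<lambda>k. CY * (K * \<epsilon> k)) \<longlonglongrightarrow> 0"
      using tendsto_mult[OF tendsto_const[of CY] tendsto_mult[OF tendsto_const[of K] \<epsilon>(4)]] by simp
  qed
  have w_cont: "continuous_on {0..T} (w k)" for k
    unfolding w_def by (intro continuous_on_matrix_vector cycle_continuous_compose continuous_intros u)
  obtain CZ where CZ: "CZ > 0" "\<And>t. t \<in> {0..T} \<Longrightarrow> norm (z0 (t + \<theta>)) \<le> CZ"
  proof -
    have "bounded ((\<lambda>t. z0 (t + \<theta>)) ` {0..T})"
      by (intro compact_imp_bounded compact_continuous_image cycle_continuous_compose continuous_intros) auto
    then show thesis using that unfolding bounded_pos by auto
  qed
  define B where "B t = CZ * (CY * K + b t)" for t
  have B_int: "B integrable_on {0..T}"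
    unfolding B_def using b_int by (intro integrable_on_mult_right integrable_add integrable_const_ivl)
  have forceB: "norm (force (\<epsilon> k) t \<theta> (w k t)) \<le> \<epsilon> k * (CY * K + b t)" if t: "t \<in> {0..T}" for k t
  proof -
    have "norm (force (\<epsilon> k) t \<theta> (w k t)) \<le> CY * (K * \<epsilon> k) + \<epsilon> k * b t"
    proof (rule force_bound[OF t \<epsilon>01])
      show "norm (w k t) \<le> 1" using w_le[OF t, of k] \<epsilon>(3)[of k] by linarith
      have "norm (remainder (t + \<theta>) (w k t)) \<le> norm (w k t)"
        by (rule \<rho>) (use w_le[OF t, of k] \<epsilon>(3)[of k] in linarith)
      then show "norm (remainder (t + \<theta>) (w k t)) \<le> CY * (K * \<epsilon> k)" using w_le[OF t, of k] by linarith
    qed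
    then show ?thesis by (simp add: algebra_simps)
  qed
  obtain CV where CV: "CV > 0" "\<And>t v. t \<in> {0..T} \<Longrightarrow> norm (V (t + \<theta>) *v v) \<le> CV * norm v"
  proof (rule compact_continuous_matrix_bound)
    show "continuous_on {0..T} (\<lambda>t. V (t + \<theta>))"
      by (intro cycle_continuous_compose continuous_intros)
  qed auto
  have drift_int: "(\<lambda>t. drift (\<epsilon> k) t (\<theta>, u k t)) integrable_on {0..T}" for k
  proof (rule measurable_bounded_by_integrable_imp_integrable[OF drift_measurable[OF \<epsilon>01 u(1)]])
    show "(\<lambda>t. CV * (\<epsilon> k * (CY * K + b t))) integrable_on {0..T}"
      using b_int by (intro integrable_on_mult_right integrable_add integrable_const_ivl)
    show "norm (drift (\<epsilon> k) t (\<theta>, u k t)) \<le> CV * (\<epsilon> k * (CY * K + b t))" if t: "t \<in> {0..T}" for t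
    proof -
      have "norm (drift (\<epsilon> k) t (\<theta>, u k t)) \<le> CV * norm (force (\<epsilon> k) t \<theta> (w k t))"
        using CV(2)[OF t] by (simp add: drift_def w_def)
      also have "\<dots> \<le> CV * (\<epsilon> k * (CY * K + b t))"
        using forceB[OF t] CV(1) by (intro mult_left_mono) auto
      finally show ?thesis .
    qed
  qed auto
  define F where "F k t = (z0 (t + \<theta>) \<bullet> force (\<epsilon> k) t \<theta> (w k t)) / \<epsilon> k" for k t
  have pair: "(z0 0 \<bullet> drift (\<epsilon> k) t (\<theta>, u k t)) / \<epsilon> k = F k t" for k t
    by (simp add: F_def adjoint_drift w_def)
  have lin: "bounded_linear (\<lambda>v. (z0 0 \<bullet> v) / \<epsilon> k)" for k
    by (rule bounded_linear_compose[OF bounded_linear_divide bounded_linear_inner_right])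
  have F_int: "F k integrable_on {0..T}" and F_eq: "integral {0..T} (F k)
      = (z0 0 \<bullet> integral {0..T} (\<lambda>t. drift (\<epsilon> k) t (\<theta>, u k t))) / \<epsilon> k" for k
    using integrable_linear[OF drift_int[of k] lin[of k]] integral_linear[OF drift_int[of k] lin[of k]]
    by (simp_all add: o_def pair)
  have "(\<lambda>k. integral {0..T} (F k)) \<longlonglongrightarrow> integral {0..T} (\<lambda>t. z0 (t + \<theta>) \<bullet> \<Phi> t (x0 (t + \<theta>)) 0)"
  proof (rule dominated_convergence(2)[OF F_int B_int])
    fix t assume t: "t \<in> {0..T}"
    show "norm (F k t) \<le> B t" for k
    proof -
      have "norm (z0 (t + \<theta>) \<bullet> force (\<epsilon> k) t \<theta> (w k t)) \<le> norm (z0 (t + \<theta>)) * norm (force (\<epsilon> k) t \<theta> (w k t))"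
        by (simp add: Cauchy_Schwarz_ineq2)
      also have "\<dots> \<le> CZ * (\<epsilon> k * (CY * K + b t))"
        using CZ forceB[OF t] t by (intro mult_mono) auto
      finally show ?thesis using \<epsilon>(1)[of k] by (simp add: F_def B_def divide_le_eq mult_ac)
    qed
    have rem: "(\<lambda>k. remainder (t + \<theta>) (w k t) /\<^sub>R \<epsilon> k) \<longlonglongrightarrow> 0"
    proof (rule tendstoI)
      fix e :: real assume e: "e > 0"
      define e' where "e' = e / (CY * \<bar>K\<bar> + 1)"
      have pos: "CY * \<bar>K\<bar> + 1 > 0" using CY(1) by (simp add: add_nonneg_pos)
      have e': "e' > 0" using e pos by (simp add: e'_def)
      obtain \<rho>' where \<rho>': "\<rho>' > 0" "\<And>\<tau> w. norm w \<le> \<rho>' \<Longrightarrow> norm (remainder \<tau> w) \<le> e' * norm w"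
        using remainder_small[OF e'] by metis
      have "\<forall>\<^sub>F k in sequentially. dist (w k t) 0 < \<rho>'" by (rule tendstoD[OF w_lim[OF t] \<rho>'(1)])
      then show "\<forall>\<^sub>F k in sequentially. dist (remainder (t + \<theta>) (w k t) /\<^sub>R \<epsilon> k) 0 < e"
      proof eventually_elim
        case (elim k)
        have "norm (remainder (t + \<theta>) (w k t)) \<le> e' * norm (w k t)" using elim by (intro \<rho>') simp
        also have "\<dots> \<le> e' * (CY * (K * \<epsilon> k))" using w_le[OF t, of k] e' by (intro mult_left_mono) auto
        also have "\<dots> \<le> e' * (CY * \<bar>K\<bar>) * \<epsilon> k"
          using e' CY(1) \<epsilon>(1)[of k] by (simp add: mult.assoc mult_left_mono mult_right_mono)
        also have "\<dots> < e' * (CY * \<bar>K\<bar> + 1) * \<epsilon> k" using e' \<epsilon>(1)[of k] by simp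
        also have "\<dots> = e * \<epsilon> k" using pos by (simp add: e'_def)
        finally show ?case using \<epsilon>(1)[of k] by (simp add: field_simps)
      qed
    qed
    have "(\<lambda>k. (x0 (t + \<theta>) + w k t, \<epsilon> k)) \<longlonglongrightarrow> (x0 (t + \<theta>) + 0, 0)"
      by (intro tendsto_intros w_lim t \<epsilon>(4))
    then have "(\<lambda>k. \<Phi> t (x0 (t + \<theta>) + w k t) (\<epsilon> k)) \<longlonglongrightarrow> \<Phi> t (x0 (t + \<theta>)) 0"
      using continuous_on_tendsto_compose[OF \<Phi>_cont[of t], of "\<lambda>k. (x0 (t + \<theta>) + w k t, \<epsilon> k)" "(x0 (t + \<theta>), 0)" sequentially] \<epsilon>01
      by auto
    with rem have "(\<lambda>k. z0 (t + \<theta>) \<bullet> (remainder (t + \<theta>) (w k t) /\<^sub>R \<epsilon> k + \<Phi> t (x0 (t + \<theta>) + w k t) (\<epsilon> k)))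
        \<longlonglongrightarrow> z0 (t + \<theta>) \<bullet> (0 + \<Phi> t (x0 (t + \<theta>)) 0)"
      by (intro tendsto_intros)
    moreover have "z0 (t + \<theta>) \<bullet> (remainder (t + \<theta>) (w k t) /\<^sub>R \<epsilon> k + \<Phi> t (x0 (t + \<theta>) + w k t) (\<epsilon> k)) = F k t" for k
      using \<epsilon>(1)[of k] by (simp add: F_def force_def inner_add_right field_simps)
    ultimately show "(\<lambda>k. F k t) \<longlonglongrightarrow> z0 (t + \<theta>) \<bullet> \<Phi> t (x0 (t + \<theta>)) 0" by simp
  qed
  then show ?thesis by (simp add: F_eq bifurcation_def)
qed

end

section \<open>Solvability of the periodic boundary value problem\<close>

context perturbed_limit_cycle
begin

text \<open>The integral equation for \<open>u\<close> together with the condition that makes \<open>x\<^sub>0(t + \<theta>) + Y(t + \<theta>) u(t)\<close> take the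
same value at \<open>0\<close> and at \<open>T\<close>.\<close>

definition boundary_solution :: "real \<Rightarrow> real \<Rightarrow> (real \<Rightarrow> real^'n) \<Rightarrow> bool" where
  "boundary_solution \<epsilon> \<theta> u \<longleftrightarrow>
     (\<lambda>t. drift \<epsilon> t (\<theta>, u t)) absolutely_integrable_on {0..T} \<and>
     (\<forall>t\<in>{0..T}. u t = u 0 + integral {0..t} (\<lambda>s. drift \<epsilon> s (\<theta>, u s))) \<and>
     Y T *v u T = u 0"

text \<open>The threshold \<open>\<epsilon>1\<close> must serve all functions \<open>u\<close> of size \<open>K \<epsilon>\<close> at once. If none did, a sequence of
counterexamples with \<open>\<epsilon>\<close> tending to zero would contradict
\<open>scaled_boundary_integral_tendsto\<close>.\<close>

lemma boundary_integral_sign: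
  assumes CY: "CY > 0" "\<And>t v. t \<in> {0..T} \<Longrightarrow> norm (Y (t + \<theta>) *v v) \<le> CY * norm v"
    and \<rho>: "\<rho> > 0" "\<And>\<tau> w. norm w \<le> \<rho> \<Longrightarrow> norm (remainder \<tau> w) \<le> norm w"
    and K: "K > 0" and sign: "s * bifurcation \<theta> > 0"
  obtains \<epsilon>1 where "\<epsilon>1 > 0"
    "\<And>\<epsilon> u. 0 < \<epsilon> \<Longrightarrow> \<epsilon> < \<epsilon>1 \<Longrightarrow> continuous_on {0..T} u \<Longrightarrow>
       (\<And>t. t \<in> {0..T} \<Longrightarrow> norm (u t) \<le> K * \<epsilon>) \<Longrightarrow>
       s * (z0 0 \<bullet> integral {0..T} (\<lambda>t. drift \<epsilon> t (\<theta>, u t))) > 0"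
proof -
  define I where "I \<epsilon> u = z0 0 \<bullet> integral {0..T} (\<lambda>t. drift \<epsilon> t (\<theta>, u t))" for \<epsilon> u
  \<comment> \<open>For \<open>\<epsilon> \<le> a\<close> the displacement \<open>Y u\<close> is at most \<open>min 1 \<rho>\<close>, so both the bound \<open>b\<close> and the estimate
    of the remainder apply.\<close>
  define a where "a = min 1 (min 1 \<rho> / (CY * K))"
  have a: "a > 0" using \<rho>(1) CY(1) K by (simp add: a_def)
  have "\<exists>\<epsilon>1>0. \<forall>\<epsilon> u. 0 < \<epsilon> \<longrightarrow> \<epsilon> < \<epsilon>1 \<longrightarrow> continuous_on {0..T} u \<longrightarrow>
      (\<forall>t\<in>{0..T}. norm (u t) \<le> K * \<epsilon>) \<longrightarrow> s * I \<epsilon> u > 0"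
  proof (rule ccontr)
    assume neg: "\<not> ?thesis"
    have "\<exists>\<epsilon> u. 0 < \<epsilon> \<and> \<epsilon> < a / Suc k \<and> continuous_on {0..T} u \<and>
        (\<forall>t\<in>{0..T}. norm (u t) \<le> K * \<epsilon>) \<and> \<not> s * I \<epsilon> u > 0" for k
    proof (rule ccontr)
      assume "\<not> ?thesis"
      then have "\<forall>\<epsilon> u. 0 < \<epsilon> \<longrightarrow> \<epsilon> < a / Suc k \<longrightarrow> continuous_on {0..T} u \<longrightarrow>
          (\<forall>t\<in>{0..T}. norm (u t) \<le> K * \<epsilon>) \<longrightarrow> s * I \<epsilon> u > 0" by blast
      moreover have "a / Suc k > 0" using a by simp
      ultimately show False using neg by blast
    qed
    then obtain \<epsilon> where "\<And>k. \<exists>u. 0 < \<epsilon> k \<and> \<epsilon> k < a / Suc k \<and> continuous_on {0..T} u \<and>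
        (\<forall>t\<in>{0..T}. norm (u t) \<le> K * \<epsilon> k) \<and> \<not> s * I (\<epsilon> k) u > 0" by metis
    then obtain u where "\<And>k. 0 < \<epsilon> k \<and> \<epsilon> k < a / Suc k \<and> continuous_on {0..T} (u k) \<and>
        (\<forall>t\<in>{0..T}. norm (u k t) \<le> K * \<epsilon> k) \<and> \<not> s * I (\<epsilon> k) (u k) > 0" by metis
    then have \<epsilon>: "\<And>k. 0 < \<epsilon> k" "\<And>k. \<epsilon> k < a / Suc k"
      and u: "\<And>k. continuous_on {0..T} (u k)" "\<And>k t. t \<in> {0..T} \<Longrightarrow> norm (u k t) \<le> K * \<epsilon> k"
      and bad: "\<And>k. \<not> s * I (\<epsilon> k) (u k) > 0" by blast+
    have \<epsilon>_le_a: "\<epsilon> k \<le> a" for k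
    proof -
      have "a / Suc k \<le> a" using a by (simp add: divide_le_eq)
      then show ?thesis using \<epsilon>(2)[of k] by linarith
    qed
    have \<epsilon>_lim: "\<epsilon> \<longlonglongrightarrow> 0"
    proof (rule Lim_null_comparison)
      show "\<forall>\<^sub>F k in sequentially. norm (\<epsilon> k) \<le> a * inverse (real (Suc k))"
        using \<epsilon> by (intro always_eventually allI) (simp add: less_imp_le divide_inverse abs_of_pos del: of_nat_Suc)
      show "(\<lambda>k. a * inverse (real (Suc k))) \<longlonglongrightarrow> 0"
        using tendsto_mult[OF tendsto_const[of a] LIMSEQ_inverse_real_of_nat] by simp
    qed
    have \<epsilon>_small: "\<epsilon> k \<le> 1" "CY * (K * \<epsilon> k) \<le> min 1 \<rho>" for k
    proof -
      show "\<epsilon> k \<le> 1" using \<epsilon>_le_a[of k] by (simp add: a_def)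
      have "\<epsilon> k \<le> min 1 \<rho> / (CY * K)" using \<epsilon>_le_a[of k] by (simp add: a_def)
      then show "CY * (K * \<epsilon> k) \<le> min 1 \<rho>" using CY(1) K by (simp add: pos_le_divide_eq mult_ac)
    qed
    have "(\<lambda>k. I (\<epsilon> k) (u k) / \<epsilon> k) \<longlonglongrightarrow> bifurcation \<theta>"
      unfolding I_def by (rule scaled_boundary_integral_tendsto[OF CY \<rho>(2) \<epsilon>(1) \<epsilon>_small \<epsilon>_lim u])
    then have "(\<lambda>k. s * (I (\<epsilon> k) (u k) / \<epsilon> k)) \<longlonglongrightarrow> s * bifurcation \<theta>"
      by (intro tendsto_intros)
    then have "\<forall>\<^sub>F k in sequentially. s * (I (\<epsilon> k) (u k) / \<epsilon> k) > 0"
      using sign by (rule order_tendstoD)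
    then obtain k where "s * (I (\<epsilon> k) (u k) / \<epsilon> k) > 0"
      unfolding eventually_sequentially by blast
    then show False using bad[of k] \<epsilon>(1)[of k] by (simp add: zero_less_divide_iff)
  qed
  then obtain \<epsilon>1 where "\<epsilon>1 > 0" and pos: "\<And>\<epsilon> u. 0 < \<epsilon> \<Longrightarrow> \<epsilon> < \<epsilon>1 \<Longrightarrow> continuous_on {0..T} u \<Longrightarrow>
      \<forall>t\<in>{0..T}. norm (u t) \<le> K * \<epsilon> \<Longrightarrow> s * I \<epsilon> u > 0" by blast
  show thesis
    by (rule that[OF \<open>\<epsilon>1 > 0\<close>], fold I_def, rule pos) auto
qed

text \<open>The fixed point theorem is applied to the parameters \<open>(\<theta>, u(0))\<close> in the product of the phase interval
and a ball, with both arguments of the drift cut off. If \<open>\<zeta> \<bullet> q\<close> were not zero at the fixed point, the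
phase would have been pushed to an end of its interval, and to the end at which the assumed sign
forbids it. Once \<open>\<zeta> \<bullet> q = 0\<close>, the choice \<open>u(0) = L q\<close> closes the solution up, and the smallness of the
drift keeps \<open>u(0)\<close> and \<open>u\<close> inside the ball.\<close>

lemma boundary_problem_solvable:
  fixes L :: "real^'n^'n"
  assumes \<epsilon>: "\<epsilon> \<in> {0..1}" and \<delta>: "\<delta> > 0" and R: "R \<ge> 0"
    and L: "\<And>q. z0 0 \<bullet> q = 0 \<Longrightarrow> Y T *v (L *v q + q) = L *v q"
    and CL: "CL \<ge> 0" "\<And>v. norm (L *v v) \<le> CL * norm v"
    and m: "m integrable_on {0..T}"
    and bound: "\<And>\<theta> t u. \<bar>\<theta> - \<theta>0\<bar> \<le> \<delta> \<Longrightarrow> t \<in> {0..T} \<Longrightarrow> norm u \<le> R \<Longrightarrow> norm (drift \<epsilon> t (\<theta>, u)) \<le> m t"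
    and small: "(1 + CL) * integral {0..T} m \<le> R"
    and right: "\<And>u. continuous_on {0..T} u \<Longrightarrow> (\<And>t. t \<in> {0..T} \<Longrightarrow> norm (u t) \<le> R) \<Longrightarrow>
       s * (z0 0 \<bullet> integral {0..T} (\<lambda>t. drift \<epsilon> t (\<theta>0 + \<delta>, u t))) > 0"
    and left: "\<And>u. continuous_on {0..T} u \<Longrightarrow> (\<And>t. t \<in> {0..T} \<Longrightarrow> norm (u t) \<le> R) \<Longrightarrow>
       s * (z0 0 \<bullet> integral {0..T} (\<lambda>t. drift \<epsilon> t (\<theta>0 - \<delta>, u t))) < 0"
  obtains \<theta> u where "\<bar>\<theta> - \<theta>0\<bar> \<le> \<delta>" "\<forall>t\<in>{0..T}. norm (u t) \<le> R" "boundary_solution \<epsilon> \<theta> u"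
proof -
  define clamp where "clamp x = max (\<theta>0 - \<delta>) (min (\<theta>0 + \<delta>) x)" for x
  define proj where "proj = closest_point (cball (0 :: real^'n) R)"
  have clamp_in: "\<bar>clamp x - \<theta>0\<bar> \<le> \<delta>" for x using \<delta> by (auto simp: clamp_def)
  have clamp_id: "clamp x = x" if "\<bar>x - \<theta>0\<bar> \<le> \<delta>" for x using that by (auto simp: clamp_def)
  have proj_in: "norm (proj x) \<le> R" for x
    using closest_point_in_set[of "cball 0 R" x] R by (simp add: proj_def)
  have proj_id: "proj x = x" if "norm x \<le> R" for x
    using that by (simp add: proj_def closest_point_self)
  have proj_cont: "continuous_on S proj" for S
    using continuous_on_closest_point[of "cball 0 R" S] R by (simp add: proj_def)
  define G where "G t x = drift \<epsilon> t (clamp (fst (fst x)), proj (snd x))" for t and x :: "(real \<times> (real^'n)) \<times> (real^'n)"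
  define P where "P = {\<theta>0 - \<delta>..\<theta>0 + \<delta>} \<times> cball (0 :: real^'n) R"
  define \<gamma> where "\<gamma> x = (clamp (fst (fst x) - s * (z0 0 \<bullet> snd x)), proj (L *v snd x))"
    for x :: "(real \<times> (real^'n)) \<times> (real^'n)"
  have G: "caratheodory_on {0..T} m G"
    unfolding caratheodory_on_def
  proof (intro conjI allI ballI m)
    show "(\<lambda>t. G t x) \<in> borel_measurable (lebesgue_on {0..T})" for x
      unfolding G_def by (rule drift_measurable[OF \<epsilon>]) (rule continuous_on_const)
    show "norm (G t x) \<le> m t" if "t \<in> {0..T}" for t x
      unfolding G_def by (rule bound[OF clamp_in that proj_in])
    show "continuous_on UNIV (G t)" for t
      unfolding G_def[abs_def] clamp_def
      by (intro continuous_on_compose2[OF drift_continuous[OF \<epsilon>]] continuous_intros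
          continuous_on_compose2[OF proj_cont]) auto
  qed
  have P: "compact P" "convex P" "P \<noteq> {}"
    using \<delta> R unfolding P_def by (auto intro!: compact_Times convex_Times)
  have \<gamma>: "continuous_on (P \<times> UNIV) \<gamma>"
    unfolding \<gamma>_def[abs_def] clamp_def
    by (intro continuous_intros continuous_on_compose2[OF proj_cont] continuous_on_matrix_vector) auto
  have \<gamma>P: "\<gamma> (p, q) \<in> P" for p q
    using clamp_in[of "fst p - s * (z0 0 \<bullet> q)"] proj_in[of "L *v q"] by (auto simp: \<gamma>_def P_def)
  obtain p u where p: "p \<in> P" and u_cont: "continuous_on {0..T} u"
    and u_eq: "\<And>t. t \<in> {0..T} \<Longrightarrow> u t = snd p + integral {0..t} (\<lambda>s. G s (p, u s))"
    and fixp: "\<gamma> (p, integral {0..T} (\<lambda>s. G s (p, u s))) = p"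
    using volterra_boundary_fixed_point[OF T_pos G P continuous_on_snd[OF continuous_on_id] \<gamma> \<gamma>P] by blast
  define \<theta> where "\<theta> = fst p"
  define q where "q = integral {0..T} (\<lambda>s. G s (p, u s))"
  have \<theta>_in: "\<bar>\<theta> - \<theta>0\<bar> \<le> \<delta>" using p by (auto simp: P_def \<theta>_def)
  have \<theta>_fix: "\<theta> = clamp (\<theta> - s * (z0 0 \<bullet> q))" and v_fix: "snd p = proj (L *v q)"
    using fixp by (auto simp: \<gamma>_def \<theta>_def q_def prod_eq_iff)
  have pu_meas: "(\<lambda>t. (p, u t)) \<in> borel_measurable (lebesgue_on {0..t})" if "t \<in> {0..T}" for t
    by (rule borel_measurable_continuous_lebesgue_on)
       (use that in \<open>auto intro!: continuous_intros continuous_on_subset[OF u_cont]\<close>)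
  have m_nonneg: "0 \<le> m t" if "t \<in> {0..T}" for t
    using bound[of \<theta>0 t 0] that \<delta> R norm_ge_zero order_trans by (metis abs_zero diff_self less_imp_le norm_zero)
  have int_le: "norm (integral {0..t} (\<lambda>s. G s (p, u s))) \<le> integral {0..T} m" if t: "t \<in> {0..T}" for t
  proof -
    have "norm (integral {0..t} (\<lambda>s. G s (p, u s))) \<le> integral {0..t} m"
      by (rule caratheodory_on_integrable(2)[OF caratheodory_on_subset[OF G] pu_meas]) (use t in auto)
    also have "\<dots> \<le> integral {0..T} m"
      by (rule integral_subset_le) (use t m m_nonneg in \<open>auto intro: integrable_subinterval_real\<close>)
    finally show ?thesis .
  qed
  have q_le: "norm q \<le> integral {0..T} m" using int_le[of T] T_pos by (simp add: q_def)
  have Lq: "norm (L *v q) \<le> CL * integral {0..T} m"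
    using CL(2)[of q] mult_left_mono[OF q_le CL(1)] by linarith
  have im: "0 \<le> integral {0..T} m" using q_le norm_ge_zero order_trans by blast
  then have LqR: "norm (L *v q) \<le> R" using Lq small by (simp add: algebra_simps)
  then have v: "snd p = L *v q" using v_fix proj_id by simp
  have u_le: "norm (u t) \<le> R" if t: "t \<in> {0..T}" for t
  proof -
    have "norm (u t) \<le> norm (L *v q) + norm (integral {0..t} (\<lambda>s. G s (p, u s)))"
      using u_eq[OF t] norm_triangle_ineq v by metis
    then show ?thesis using Lq int_le[OF t] small by (simp add: algebra_simps)
  qed
  have G_eq: "G t (p, u t) = drift \<epsilon> t (\<theta>, u t)" if "t \<in> {0..T}" for t
    using proj_id[OF u_le[OF that]] clamp_id[OF \<theta>_in] by (simp add: G_def \<theta>_def)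
  have int_eq: "integral {0..t} (\<lambda>s. G s (p, u s)) = integral {0..t} (\<lambda>s. drift \<epsilon> s (\<theta>, u s))"
    if "t \<in> {0..T}" for t
    by (rule integral_cong) (use that G_eq in auto)
  have q_eq: "q = integral {0..T} (\<lambda>s. drift \<epsilon> s (\<theta>, u s))"
    using int_eq[of T] T_pos by (simp add: q_def)
  have "z0 0 \<bullet> q = 0"
  proof (rule ccontr)
    assume nz: "z0 0 \<bullet> q \<noteq> 0"
    have "s \<noteq> 0" using right[OF u_cont u_le] by auto
    then have "s * (z0 0 \<bullet> q) \<noteq> 0" using nz by simp
    then consider "s * (z0 0 \<bullet> q) > 0" | "s * (z0 0 \<bullet> q) < 0" by linarith
    then show False
    proof cases
      case 1
      then have "\<theta> = \<theta>0 - \<delta>" using \<theta>_fix \<theta>_in by (auto simp: clamp_def max_def min_def split: if_splits)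
      then show False using left[OF u_cont u_le] 1 by (simp add: q_eq)
    next
      case 2
      then have "\<theta> = \<theta>0 + \<delta>" using \<theta>_fix \<theta>_in by (auto simp: clamp_def max_def min_def split: if_splits)
      then show False using right[OF u_cont u_le] 2 by (simp add: q_eq)
    qed
  qed
  have u0: "u 0 = L *v q" using u_eq[of 0] T_pos v by simp
  show thesis
  proof
    show "\<bar>\<theta> - \<theta>0\<bar> \<le> \<delta>" by fact
    show "\<forall>t\<in>{0..T}. norm (u t) \<le> R" using u_le by blast
    show "boundary_solution \<epsilon> \<theta> u"
      unfolding boundary_solution_def
    proof (intro conjI ballI)
      have "(\<lambda>t. G t (p, u t)) absolutely_integrable_on {0..T}"
        by (rule caratheodory_on_integrable(1)[OF G pu_meas]) (use T_pos in auto)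
      then show "(\<lambda>t. drift \<epsilon> t (\<theta>, u t)) absolutely_integrable_on {0..T}"
        by (rule absolutely_integrable_spike[where S = "{}"]) (auto simp: G_eq)
      show "u t = u 0 + integral {0..t} (\<lambda>s. drift \<epsilon> s (\<theta>, u s))" if "t \<in> {0..T}" for t
        using u_eq[OF that] int_eq[OF that] u0 v by simp
      have "u T = L *v q + q" using u_eq[of T] T_pos v by (simp add: q_def)
      then show "Y T *v u T = u 0" using L[OF \<open>z0 0 \<bullet> q = 0\<close>] u0 by simp
    qed
  qed
qed

text \<open>The radius of the ball can be taken proportional to \<open>\<epsilon>\<close>, with a factor \<open>K\<close> that does not depend on the
width \<open>\<delta>\<close> of the phase interval.\<close>

lemma boundary_problem_eventually_solvable:
  obtains K CY where "K > 0" "CY > 0"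
    "\<And>t \<theta> v. t \<in> {0..T} \<Longrightarrow> \<bar>\<theta> - \<theta>0\<bar> \<le> 1 \<Longrightarrow> norm (Y (t + \<theta>) *v v) \<le> CY * norm v"
    "\<And>\<delta> s. 0 < \<delta> \<Longrightarrow> \<delta> \<le> 1 \<Longrightarrow> s * bifurcation (\<theta>0 + \<delta>) > 0 \<Longrightarrow> s * bifurcation (\<theta>0 - \<delta>) < 0 \<Longrightarrow>
      \<forall>\<^sub>F \<epsilon> in at_right 0. \<exists>\<theta> u. \<bar>\<theta> - \<theta>0\<bar> \<le> \<delta> \<and>
        (\<forall>t\<in>{0..T}. norm (u t) \<le> K * \<epsilon>) \<and> boundary_solution \<epsilon> \<theta> u"
proof -
  obtain CY where CY: "CY > 0" "\<And>\<tau> v. \<tau> \<in> {\<theta>0 - 1..\<theta>0 + 1 + T} \<Longrightarrow> norm (Y \<tau> *v v) \<le> CY * norm v"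
    using compact_continuous_matrix_bound[OF compact_Icc Y_cont] by blast
  obtain CV where CV: "CV > 0" "\<And>\<tau> v. \<tau> \<in> {\<theta>0 - 1..\<theta>0 + 1 + T} \<Longrightarrow> norm (V \<tau> *v v) \<le> CV * norm v"
    using compact_continuous_matrix_bound[OF compact_Icc V_cont] by blast
  obtain L :: "real^'n^'n" where L: "\<And>q. z0 0 \<bullet> q = 0 \<Longrightarrow> Y T *v (L *v q + q) = L *v q"
    using boundary_operator by blast
  obtain CL where CL: "CL > 0" "\<And>v. norm (L *v v) \<le> CL * norm v"
    using compact_continuous_matrix_bound[of "{0 :: real}" "\<lambda>_. L"]
    by (metis compact_sing continuous_on_const insertI1)
  define B where "B = integral {0..T} b"
  have B: "B \<ge> 0" unfolding B_def by (rule integral_nonneg[OF b_int]) (rule b_nonneg)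
  \<comment> \<open>With \<open>|u| \<le> K \<epsilon>\<close> the drift has integral at most \<open>CV (\<eta> CY K \<epsilon> T + \<epsilon> B)\<close>. After multiplication by
    \<open>1 + CL\<close> this has to stay below \<open>K \<epsilon>\<close>: \<open>\<eta>\<close> makes the first summand equal to half of \<open>K \<epsilon>\<close>, and \<open>K\<close> makes
    the second one smaller than the other half.\<close>
  define \<eta> where "\<eta> = 1 / (2 * ((1 + CL) * CV * CY * T))"
  define K where "K = 2 * (1 + CL) * CV * B + 1"
  have \<eta>: "\<eta> > 0" using CL(1) CV(1) CY(1) T_pos by (simp add: \<eta>_def)
  have K: "K > 0" using CL(1) CV(1) B by (simp add: K_def add_nonneg_pos)
  obtain \<rho> where \<rho>: "\<rho> > 0" "\<And>\<tau> w. norm w \<le> \<rho> \<Longrightarrow> norm (remainder \<tau> w) \<le> \<eta> * norm w"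
    using remainder_small[OF \<eta>] by metis
  obtain \<rho>1 where \<rho>1: "\<rho>1 > 0" "\<And>\<tau> w. norm w \<le> \<rho>1 \<Longrightarrow> norm (remainder \<tau> w) \<le> 1 * norm w"
    using remainder_small[OF zero_less_one] by metis
  have \<rho>1': "norm (remainder \<tau> w) \<le> norm w" if "norm w \<le> \<rho>1" for \<tau> w
    using \<rho>1(2)[OF that] by simp
  have range: "t + \<theta> \<in> {\<theta>0 - 1..\<theta>0 + 1 + T}" if "t \<in> {0..T}" "\<bar>\<theta> - \<theta>0\<bar> \<le> 1" for t \<theta>
    using that by auto
  have CY': "norm (Y (t + \<theta>) *v v) \<le> CY * norm v" if "t \<in> {0..T}" "\<bar>\<theta> - \<theta>0\<bar> \<le> 1" for t \<theta> v
    by (rule CY(2)[OF range[OF that]])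
  show thesis
  proof (rule that[OF K CY(1) CY'])
    fix \<delta> s :: real
    assume \<delta>: "0 < \<delta>" "\<delta> \<le> 1" and s: "s * bifurcation (\<theta>0 + \<delta>) > 0" "s * bifurcation (\<theta>0 - \<delta>) < 0"
    have d: "\<bar>\<theta>0 + \<delta> - \<theta>0\<bar> \<le> 1" "\<bar>\<theta>0 - \<delta> - \<theta>0\<bar> \<le> 1" using \<delta> by auto
    obtain \<epsilon>1 where \<epsilon>1: "\<epsilon>1 > 0" "\<And>\<epsilon> u. 0 < \<epsilon> \<Longrightarrow> \<epsilon> < \<epsilon>1 \<Longrightarrow> continuous_on {0..T} u \<Longrightarrow>
       (\<And>t. t \<in> {0..T} \<Longrightarrow> norm (u t) \<le> K * \<epsilon>) \<Longrightarrow>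
       s * (z0 0 \<bullet> integral {0..T} (\<lambda>t. drift \<epsilon> t (\<theta>0 + \<delta>, u t))) > 0"
      using boundary_integral_sign[OF CY(1) CY'[OF _ d(1)] \<rho>1(1) \<rho>1' K s(1)] by blast
    have s2: "(- s) * bifurcation (\<theta>0 - \<delta>) > 0" using s(2) by simp
    obtain \<epsilon>2 where \<epsilon>2: "\<epsilon>2 > 0" "\<And>\<epsilon> u. 0 < \<epsilon> \<Longrightarrow> \<epsilon> < \<epsilon>2 \<Longrightarrow> continuous_on {0..T} u \<Longrightarrow>
       (\<And>t. t \<in> {0..T} \<Longrightarrow> norm (u t) \<le> K * \<epsilon>) \<Longrightarrow>
       (- s) * (z0 0 \<bullet> integral {0..T} (\<lambda>t. drift \<epsilon> t (\<theta>0 - \<delta>, u t))) > 0"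
      using boundary_integral_sign[OF CY(1) CY'[OF _ d(2)] \<rho>1(1) \<rho>1' K s2] by blast
    define \<epsilon>0 where "\<epsilon>0 = min (min \<epsilon>1 \<epsilon>2) (min 1 (min 1 \<rho> / (CY * K)))"
    have \<epsilon>0: "\<epsilon>0 > 0" using \<epsilon>1(1) \<epsilon>2(1) \<rho>(1) CY(1) K by (simp add: \<epsilon>0_def)
    show "\<forall>\<^sub>F \<epsilon> in at_right 0. \<exists>\<theta> u. \<bar>\<theta> - \<theta>0\<bar> \<le> \<delta> \<and>
        (\<forall>t\<in>{0..T}. norm (u t) \<le> K * \<epsilon>) \<and> boundary_solution \<epsilon> \<theta> u"
      unfolding eventually_at_right_field
    proof (rule exI[of _ \<epsilon>0], intro conjI allI impI \<epsilon>0)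
      fix \<epsilon> :: real assume pos: "0 < \<epsilon>" and lt: "\<epsilon> < \<epsilon>0"
      have \<epsilon>01: "\<epsilon> \<in> {0..1}" and lt1: "\<epsilon> < \<epsilon>1" and lt2: "\<epsilon> < \<epsilon>2"
        using pos lt by (auto simp: \<epsilon>0_def)
      have "\<epsilon> \<le> min 1 \<rho> / (CY * K)" using lt by (simp add: \<epsilon>0_def)
      then have R_small: "CY * (K * \<epsilon>) \<le> min 1 \<rho>" using CY(1) K by (simp add: pos_le_divide_eq mult_ac)
      define m where "m t = CV * (\<eta> * (CY * (K * \<epsilon>)) + \<epsilon> * b t)" for t
      have m: "m integrable_on {0..T}"
        unfolding m_def using b_int by (intro integrable_on_mult_right integrable_add integrable_const_ivl)
      have "integral {0..T} m = CV * (\<eta> * (CY * (K * \<epsilon>)) * T + \<epsilon> * B)"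
        unfolding m_def B_def using b_int T_pos
        by (simp add: Henstock_Kurzweil_Integration.integral_add
            [OF integrable_const_ivl integrable_on_mult_right[OF b_int]])
      then have "(1 + CL) * integral {0..T} m
          = ((1 + CL) * CV * CY * T * \<eta>) * (K * \<epsilon>) + (1 + CL) * CV * B * \<epsilon>"
        by (simp add: algebra_simps)
      also have "(1 + CL) * CV * CY * T * \<eta> = 1 / 2"
      proof -
        have "(1 + CL) * CV * CY * T \<noteq> 0" using CL(1) CV(1) CY(1) T_pos by simp
        then show ?thesis unfolding \<eta>_def by simp
      qed
      also have "1 / 2 * (K * \<epsilon>) + (1 + CL) * CV * B * \<epsilon> \<le> K * \<epsilon>"
        using pos by (simp add: K_def field_simps)
      finally have small: "(1 + CL) * integral {0..T} m \<le> K * \<epsilon>" .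
      have bound: "norm (drift \<epsilon> t (\<theta>, u)) \<le> m t"
        if "\<bar>\<theta> - \<theta>0\<bar> \<le> \<delta>" and t: "t \<in> {0..T}" and u: "norm u \<le> K * \<epsilon>" for \<theta> t u
      proof -
        have \<theta>: "\<bar>\<theta> - \<theta>0\<bar> \<le> 1" using that \<delta> by linarith
        let ?w = "Y (t + \<theta>) *v u"
        have w: "norm ?w \<le> CY * (K * \<epsilon>)"
          using CY'[OF t \<theta>, of u] mult_left_mono[OF u less_imp_le[OF CY(1)]] by linarith
        have "norm (remainder (t + \<theta>) ?w) \<le> \<eta> * norm ?w" using w R_small by (intro \<rho>) linarith
        also have "\<dots> \<le> \<eta> * (CY * (K * \<epsilon>))" using w \<eta> by (intro mult_left_mono) auto
        finally have "norm (force \<epsilon> t \<theta> ?w) \<le> \<eta> * (CY * (K * \<epsilon>)) + \<epsilon> * b t"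
          using w R_small by (intro force_bound[OF t \<epsilon>01]) linarith+
        then have "CV * norm (force \<epsilon> t \<theta> ?w) \<le> m t"
          unfolding m_def using CV(1) by (intro mult_left_mono) auto
        then show ?thesis
          using CV(2)[OF range[OF t \<theta>], of "force \<epsilon> t \<theta> ?w"] by (simp add: drift_def)
      qed
      have R: "0 \<le> K * \<epsilon>" using K pos by simp
      have left: "s * (z0 0 \<bullet> integral {0..T} (\<lambda>t. drift \<epsilon> t (\<theta>0 - \<delta>, u t))) < 0"
        if "continuous_on {0..T} u" "\<And>t. t \<in> {0..T} \<Longrightarrow> norm (u t) \<le> K * \<epsilon>" for u
        using \<epsilon>2(2)[OF pos lt2 that] by simp
      show "\<exists>\<theta> u. \<bar>\<theta> - \<theta>0\<bar> \<le> \<delta> \<and>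
        (\<forall>t\<in>{0..T}. norm (u t) \<le> K * \<epsilon>) \<and> boundary_solution \<epsilon> \<theta> u"
      proof (rule boundary_problem_solvable[OF \<epsilon>01 \<delta>(1) R L less_imp_le[OF CL(1)] CL(2) m bound small \<epsilon>1(2)[OF pos lt1] left])
        fix \<theta> u
        assume "\<bar>\<theta> - \<theta>0\<bar> \<le> \<delta>" "\<forall>t\<in>{0..T}. norm (u t) \<le> K * \<epsilon>" "boundary_solution \<epsilon> \<theta> u"
        then show ?thesis by blast
      qed
    qed
  qed
qed

end

section \<open>Periodic solutions near the cycle\<close>

text \<open>The Lebesgue integral has the value \<open>0\<close> on nonintegrable functions, so absolute integrability of the
shifted function is checked before the integral is evaluated.\<close>

lemma set_lebesgue_integral_T_periodic_shift:
  fixes f :: "real \<Rightarrow> real"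
  assumes T: "T > 0" and per: "T_periodic T f" and f: "f absolutely_integrable_on {0..T}"
  shows "(LINT \<tau>:{0..T}|lebesgue. f (\<tau> - \<theta>)) = integral {0..T} f"
proof -
  have fi: "f integrable_on {0..T}" and ni: "(\<lambda>t. norm (f t)) integrable_on {0..T}"
    using f unfolding absolutely_integrable_on_def by auto
  have "T_periodic T (\<lambda>t. norm (f t))" using per by (simp add: T_periodic_def)
  from has_integral_shift_real_ivl[OF has_integral_T_periodic[OF T this ni, of "- \<theta>"], of "- \<theta>"]
  have "((\<lambda>\<tau>. norm (f (\<tau> - \<theta>))) has_integral integral {0..T} (\<lambda>t. norm (f t))) {0..T}" by simp
  moreover have *: "((\<lambda>\<tau>. f (\<tau> - \<theta>)) has_integral integral {0..T} f) {0..T}"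
    using has_integral_shift_real_ivl[OF has_integral_T_periodic[OF T per fi, of "- \<theta>"], of "- \<theta>"] by simp
  ultimately have "(\<lambda>\<tau>. f (\<tau> - \<theta>)) absolutely_integrable_on {0..T}"
    unfolding absolutely_integrable_on_def by (auto simp: integrable_on_def)
  then have "(LINT \<tau>:{0..T}|lebesgue. f (\<tau> - \<theta>)) = integral {0..T} (\<lambda>\<tau>. f (\<tau> - \<theta>))"
    by (rule set_lebesgue_integral_eq_integral(2))
  also have "\<dots> = integral {0..T} f" by (rule integral_unique[OF *])
  finally show ?thesis .
qed

context perturbed_limit_cycle
begin

lemma malkin_function_eq_bifurcation:
  assumes per: "\<And>x. T_periodic T (\<lambda>t. \<phi> t x 0)"
    and N: "negligible N" "\<And>t x. t \<notin> N \<Longrightarrow> \<Phi> t x 0 = \<phi> t x 0"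
  shows "malkin_function T \<phi> x0 z0 \<theta> = sgn (\<psi> (x0 0) \<bullet> z0 0) * bifurcation \<theta>"
proof -
  define f where "f t = z0 (t + \<theta>) \<bullet> \<phi> t (x0 (t + \<theta>)) 0" for t
  define h where "h t = z0 (t + \<theta>) \<bullet> \<Phi> t (x0 (t + \<theta>)) 0" for t
  have per_f: "T_periodic T f"
    using per x0_periodic z0_periodic
    unfolding T_periodic_def f_def by (metis add.assoc add.commute)
  have z_cont: "continuous_on {0..T} (\<lambda>t. z0 (t + \<theta>))" and x_cont: "continuous_on {0..T} (\<lambda>t. x0 (t + \<theta>))"
    by (intro cycle_continuous_compose continuous_intros)+
  obtain CZ where CZ: "CZ > 0" "\<And>t. t \<in> {0..T} \<Longrightarrow> norm (z0 (t + \<theta>)) \<le> CZ"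
    using compact_imp_bounded[OF compact_continuous_image[OF z_cont compact_Icc]] unfolding bounded_pos by auto
  have "h absolutely_integrable_on {0..T}"
  proof (rule measurable_bounded_by_integrable_imp_absolutely_integrable)
    show "h \<in> borel_measurable (lebesgue_on {0..T})"
      unfolding h_def
      by (intro borel_measurable_inner borel_measurable_continuous_lebesgue_on z_cont \<Phi>_superposition x_cont) simp
    show "(\<lambda>t. CZ * b t) integrable_on {0..T}" by (rule integrable_on_mult_right[OF b_int])
    show "norm (h t) \<le> CZ * b t" if t: "t \<in> {0..T}" for t
    proof -
      have "norm (\<Phi> t (x0 (t + \<theta>)) 0) \<le> b t"
        using x0_le[of "t + \<theta>"] by (intro \<Phi>_bound t) auto
      then have "norm (z0 (t + \<theta>)) * norm (\<Phi> t (x0 (t + \<theta>)) 0) \<le> CZ * b t"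
        using CZ t by (intro mult_mono) auto
      then show ?thesis unfolding h_def real_norm_def using Cauchy_Schwarz_ineq2 order_trans by blast
    qed
  qed auto
  then have "f absolutely_integrable_on {0..T}"
    by (rule absolutely_integrable_spike[OF _ N(1)]) (simp add: f_def h_def N(2))
  from set_lebesgue_integral_T_periodic_shift[OF T_pos per_f this, of \<theta>]
  have "(LINT \<tau>:{0..T}|lebesgue. z0 \<tau> \<bullet> \<phi> (\<tau> - \<theta>) (x0 \<tau>) 0) = integral {0..T} f"
    by (simp add: f_def)
  also have "\<dots> = bifurcation \<theta>"
    unfolding bifurcation_def by (rule integral_spike[OF N(1)]) (simp add: f_def N(2))
  finally show ?thesis
    using vector_derivative_at[OF x0_deriv, of 0] by (simp add: malkin_function_def)
qed

text \<open>Back to the original variables. The function \<open>x\<close> is the periodic extension of the restriction to \<open>[0, T]\<close>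
of \<open>x\<^sub>0(t + \<theta>) + Y(t + \<theta>) u(t)\<close>; the two endpoint values agree by the boundary condition. Absolute
continuity follows from a bound of the increments by the integral of \<open>\<Lambda> + CY |u'|\<close>, and the equation
holds at almost every time by the product rule.\<close>

lemma periodic_solution_of_boundary_problem:
  assumes N: "negligible N" "\<And>t x. t \<notin> N \<Longrightarrow> \<Phi> t x \<epsilon> = \<phi> t x \<epsilon>"
    and CY: "CY > 0" "\<And>t v. t \<in> {0..T} \<Longrightarrow> norm (Y (t + \<theta>) *v v) \<le> CY * norm v"
    and u: "\<And>t. t \<in> {0..T} \<Longrightarrow> norm (u t) \<le> R"
    and sol: "boundary_solution \<epsilon> \<theta> u"
  obtains x where "caratheodory_periodic_solution T (\<lambda>t v. \<psi> v + \<epsilon> *\<^sub>R \<phi> t v \<epsilon>) x"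
    "\<forall>t\<in>{0..T}. x t = x0 (t + \<theta>) + Y (t + \<theta>) *v u t"
proof -
  define g where "g t = drift \<epsilon> t (\<theta>, u t)" for t
  note parts = sol[unfolded boundary_solution_def, folded g_def]
  have ai: "g absolutely_integrable_on {0..T}" by (rule parts[THEN conjunct1])
  have ueq': "\<forall>t\<in>{0..T}. u t = u 0 + integral {0..t} g"
    by (rule parts[THEN conjunct2, THEN conjunct1])
  have bc: "Y T *v u T = u 0" by (rule parts[THEN conjunct2, THEN conjunct2])
  note ueq = bspec[OF ueq']
  have gi: "g integrable_on {0..T}" and ngi: "(\<lambda>t. norm (g t)) integrable_on {0..T}"
    using ai unfolding absolutely_integrable_on_def by auto
  define xs where "xs t = x0 (t + \<theta>) + Y (t + \<theta>) *v u t" for t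
  define x where "x t = xs (t - of_int \<lfloor>t / T\<rfloor> * T)" for t
  have closed: "xs T = xs 0"
  proof -
    have "Y (T + \<theta>) *v u T = Y \<theta> *v u 0"
      using Y_add_T[of \<theta> "u T"] bc by (simp add: add.commute)
    moreover have "x0 (T + \<theta>) = x0 \<theta>"
      using x0_periodic unfolding T_periodic_def by (metis add.commute)
    ultimately show ?thesis by (simp add: xs_def)
  qed
  have x_eq: "x t = xs t" if t: "t \<in> {0..T}" for t
  proof (cases "t = T")
    case True
    then show ?thesis using closed T_pos by (simp add: x_def)
  next
    case False
    then have "0 \<le> t / T" "t / T < 1" using t T_pos by auto
    then have "\<lfloor>t / T\<rfloor> = 0" by linarith
    then show ?thesis by (simp add: x_def)
  qed
  have per: "T_periodic T x"
    unfolding T_periodic_def x_def using T_pos by (simp add: add_divide_distrib algebra_simps)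

  have x0_shift: "((\<lambda>t. x0 (t + \<theta>)) has_vector_derivative \<psi> (x0 (t + \<theta>))) (at t)" for t
    by (rule has_vector_derivative_translate[OF x0_deriv])
  have Y_shift: "((\<lambda>t. Y (t + \<theta>)) has_vector_derivative J (t + \<theta>) ** Y (t + \<theta>)) (at t)" for t
    by (rule has_vector_derivative_translate[OF Y_deriv])

  have ac: "absolutely_continuous_fun_on {0..T} x"
  proof -
    have "continuous_on {0..T} (\<lambda>t. \<psi> (x0 (t + \<theta>)))"
      by (intro continuous_on_compose2[OF \<psi>_cont] cycle_continuous_compose continuous_intros) auto
    then have "bounded ((\<lambda>t. \<psi> (x0 (t + \<theta>))) ` {0..T})"
      by (intro compact_imp_bounded compact_continuous_image) auto
    then obtain C\<psi> where "\<forall>v\<in>(\<lambda>t. \<psi> (x0 (t + \<theta>))) ` {0..T}. norm v \<le> C\<psi>"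
      unfolding bounded_iff by (elim exE)
    then have C\<psi>: "norm (\<psi> (x0 (t + \<theta>))) \<le> C\<psi>" if "t \<in> {0..T}" for t
      using that by simp
    obtain CJ where CJ: "CJ > 0" "\<And>t v. norm (J t *v v) \<le> CJ * norm v" using J_bound by blast
    have "0 \<le> R" using u[of 0] T_pos norm_ge_zero[of "u 0"] by (metis atLeastAtMost_iff less_imp_le order_refl order_trans)
    then have CJ0: "0 \<le> CJ * CY * R" using CJ(1) CY(1) by simp
    define \<Lambda> where "\<Lambda> = C\<psi> + CJ * CY * R"
    have \<Lambda>0: "0 \<le> \<Lambda>"
    proof -
      have "0 \<le> norm (\<psi> (x0 (0 + \<theta>)))" "norm (\<psi> (x0 (0 + \<theta>))) \<le> C\<psi>"
        using C\<psi>[of 0] T_pos by simp_all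
      then show ?thesis using CJ0 unfolding \<Lambda>_def by linarith
    qed
    have ud: "u t - u s = integral {s..t} g" if "0 \<le> s" "s \<le> t" "t \<le> T" for s t
      using Henstock_Kurzweil_Integration.integral_combine
        [OF that(1,2) integrable_subinterval_real[OF gi]] that ueq[of s] ueq[of t]
      by (auto simp: algebra_simps)
    have lip: "norm (x t - x s) \<le> integral {s..t} (\<lambda>t. \<Lambda> + CY * norm (g t))"
      if st: "0 \<le> s" "s \<le> t" "t \<le> T" for s t
    proof -
      \<comment> \<open>Freezing \<open>u\<close> at its value at time \<open>t\<close> splits the increment of \<open>x\<close> into that of a smooth function and
        the image of the increment of \<open>u\<close> under \<open>Y\<close>.\<close>
      define X where "X \<tau> = x0 (\<tau> + \<theta>) + Y (\<tau> + \<theta>) *v u t" for \<tau>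
      have X_deriv: "(X has_vector_derivative
          \<psi> (x0 (\<tau> + \<theta>)) + J (\<tau> + \<theta>) *v (Y (\<tau> + \<theta>) *v u t)) (at \<tau>)" for \<tau>
      proof -
        have "((\<lambda>\<tau>. Y (\<tau> + \<theta>) *v u t) has_vector_derivative (J (\<tau> + \<theta>) ** Y (\<tau> + \<theta>)) *v u t) (at \<tau>)"
          by (rule bounded_linear.has_vector_derivative
              [OF bounded_bilinear.bounded_linear_left[OF bounded_bilinear_matrix_vector_mult] Y_shift])
        from has_vector_derivative_add[OF x0_shift this] show ?thesis
          by (simp add: X_def[abs_def] matrix_vector_mul_assoc)
      qed
      have "norm (X t - X s) \<le> \<Lambda> * norm (t - s)"
      proof (rule differentiable_bound[where S = "{s..t}" and f' = "\<lambda>\<tau> h. h *\<^sub>R (\<psi> (x0 (\<tau> + \<theta>)) + J (\<tau> + \<theta>) *v (Y (\<tau> + \<theta>) *v u t))"])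
        fix \<tau> assume \<tau>: "\<tau> \<in> {s..t}"
        then have \<tau>': "\<tau> \<in> {0..T}" using st by auto
        show "(X has_derivative (\<lambda>h. h *\<^sub>R (\<psi> (x0 (\<tau> + \<theta>)) + J (\<tau> + \<theta>) *v (Y (\<tau> + \<theta>) *v u t)))) (at \<tau> within {s..t})"
          using X_deriv[of \<tau>] unfolding has_vector_derivative_def by (rule has_derivative_at_withinI)
        have "norm (J (\<tau> + \<theta>) *v (Y (\<tau> + \<theta>) *v u t)) \<le> CJ * norm (Y (\<tau> + \<theta>) *v u t)" by (rule CJ(2))
        also have "\<dots> \<le> CJ * (CY * R)"
        proof (rule mult_left_mono[OF _ less_imp_le[OF CJ(1)]])
          have "norm (Y (\<tau> + \<theta>) *v u t) \<le> CY * norm (u t)" by (rule CY(2)[OF \<tau>'])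
          also have "\<dots> \<le> CY * R" using u[of t] st CY(1) by (intro mult_left_mono) auto
          finally show "norm (Y (\<tau> + \<theta>) *v u t) \<le> CY * R" .
        qed
        finally have "norm (\<psi> (x0 (\<tau> + \<theta>)) + J (\<tau> + \<theta>) *v (Y (\<tau> + \<theta>) *v u t)) \<le> \<Lambda>"
          using C\<psi>[OF \<tau>'] norm_triangle_ineq[of "\<psi> (x0 (\<tau> + \<theta>))" "J (\<tau> + \<theta>) *v (Y (\<tau> + \<theta>) *v u t)"]
          by (simp add: \<Lambda>_def mult.assoc)
        then show "onorm (\<lambda>h. h *\<^sub>R (\<psi> (x0 (\<tau> + \<theta>)) + J (\<tau> + \<theta>) *v (Y (\<tau> + \<theta>) *v u t))) \<le> \<Lambda>"
          by (intro onorm_le) (simp add: mult.commute[of \<Lambda>] mult_left_mono)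
      qed (use st in auto)
      moreover have "xs t - xs s = (X t - X s) + Y (s + \<theta>) *v (u t - u s)"
        by (simp add: xs_def X_def matrix_vector_mult_diff_distrib)
      moreover have "norm (Y (s + \<theta>) *v (u t - u s)) \<le> CY * integral {s..t} (\<lambda>t. norm (g t))"
      proof -
        have "norm (u t - u s) \<le> integral {s..t} (\<lambda>t. norm (g t))"
          unfolding ud[OF st]
          by (rule integral_norm_bound_integral) (use st gi ngi in \<open>auto intro: integrable_subinterval_real\<close>)
        then have "CY * norm (u t - u s) \<le> CY * integral {s..t} (\<lambda>t. norm (g t))"
          using CY(1) by (intro mult_left_mono) auto
        then show ?thesis using CY(2)[of s "u t - u s"] st by auto
      qed
      ultimately have "norm (xs t - xs s) \<le> \<Lambda> * (t - s) + CY * integral {s..t} (\<lambda>t. norm (g t))"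
        using norm_triangle_ineq[of "X t - X s" "Y (s + \<theta>) *v (u t - u s)"] st by simp
      also have "\<dots> = integral {s..t} (\<lambda>t. \<Lambda> + CY * norm (g t))"
      proof -
        have "(\<lambda>t. norm (g t)) integrable_on {s..t}"
          by (rule integrable_subinterval_real[OF ngi]) (use st in auto)
        from Henstock_Kurzweil_Integration.integral_add[OF integrable_const_ivl integrable_on_mult_right[OF this], of \<Lambda> CY]
        show ?thesis using st by simp
      qed
      finally show ?thesis using x_eq[of s] x_eq[of t] st by simp
    qed
    show ?thesis
    proof (rule absolutely_continuous_fun_onI[OF _ _ lip])
      show "(\<lambda>t. \<Lambda> + CY * norm (g t)) integrable_on {0..T}"
        by (intro integrable_add integrable_on_mult_right ngi integrable_const_ivl)
      show "0 \<le> \<Lambda> + CY * norm (g s)" for s using \<Lambda>0 CY(1) by simp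
    qed
  qed

  have "AE t in lebesgue. t \<in> {0<..<T} \<longrightarrow> ((\<lambda>t. integral {0..t} g) has_vector_derivative g t) (at t)"
    by (rule indefinite_integral_AE_vector_derivative[OF gi])
  moreover have "AE t in lebesgue. t \<notin> N \<union> {0, T}"
    by (rule AE_not_in) (use N(1) in \<open>auto simp: negligible_iff_null_sets[symmetric] intro: negligible_finite\<close>)
  ultimately have ae: "AE t in lebesgue. t \<in> {0..T} \<longrightarrow>
      (x has_vector_derivative \<psi> (x t) + \<epsilon> *\<^sub>R \<phi> t (x t) \<epsilon>) (at t)"
  proof eventually_elim
    case (elim t)
    show ?case
    proof
      assume "t \<in> {0..T}"
      then have t: "t \<in> {0<..<T}" and tN: "t \<notin> N" using elim(2) by auto
      then have t': "t \<in> {0..T}" by auto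
      have "((\<lambda>t. u 0 + integral {0..t} g) has_vector_derivative 0 + g t) (at t)"
        using elim(1) t by (intro has_vector_derivative_add has_vector_derivative_const) auto
      then have "(u has_vector_derivative 0 + g t) (at t)"
      proof (rule has_vector_derivative_transform_within_open[where S = "{0<..<T}"])
        show "u 0 + integral {0..s} g = u s" if "s \<in> {0<..<T}" for s
          using ueq[of s] that by auto
      qed (use t in auto)
      from bounded_bilinear.has_vector_derivative[OF bounded_bilinear_matrix_vector_mult Y_shift this]
      have "(xs has_vector_derivative \<psi> (x0 (t + \<theta>)) +
          (Y (t + \<theta>) *v (0 + g t) + (J (t + \<theta>) ** Y (t + \<theta>)) *v u t)) (at t)"
        unfolding xs_def[abs_def] by (intro has_vector_derivative_add x0_shift)
      also have "\<psi> (x0 (t + \<theta>)) + (Y (t + \<theta>) *v (0 + g t) + (J (t + \<theta>) ** Y (t + \<theta>)) *v u t)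
          = \<psi> (xs t) + \<epsilon> *\<^sub>R \<phi> t (xs t) \<epsilon>"
      proof -
        have "Y (t + \<theta>) *v (0 + g t) = force \<epsilon> t \<theta> (Y (t + \<theta>) *v u t)"
          by (simp add: g_def drift_def Y_V)
        then show ?thesis
          using N(2)[OF tN] by (simp add: force_def remainder_def xs_def flip: matrix_vector_mul_assoc)
      qed
      finally have "(xs has_vector_derivative \<psi> (xs t) + \<epsilon> *\<^sub>R \<phi> t (xs t) \<epsilon>) (at t)" .
      then have "(x has_vector_derivative \<psi> (xs t) + \<epsilon> *\<^sub>R \<phi> t (xs t) \<epsilon>) (at t)"
        by (rule has_vector_derivative_transform_within_open[where S = "{0<..<T}"]) (use t x_eq in auto)
      then show "(x has_vector_derivative \<psi> (x t) + \<epsilon> *\<^sub>R \<phi> t (x t) \<epsilon>) (at t)"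
        by (simp add: x_eq[OF t'])
    qed
  qed
  show thesis
    by (rule that[of x]) (use per ac ae x_eq in \<open>auto simp: caratheodory_periodic_solution_def xs_def\<close>)
qed

end

text \<open>A diagonal argument without sequences: for each \<open>\<epsilon>\<close> take an \<open>x\<close> whose distance from \<open>y\<close> exceeds the
infimum of the possible distances by at most \<open>\<epsilon>\<close>.\<close>

lemma choose_convergent_family:
  fixes y :: "'t \<Rightarrow> 'a::real_normed_vector"
  assumes "\<And>d. d > 0 \<Longrightarrow> \<forall>\<^sub>F \<epsilon> in at_right (0::real). \<exists>x. S \<epsilon> x \<and> (\<forall>t\<in>A. norm (x t - y t) \<le> d)"
  obtains x where "\<forall>\<^sub>F \<epsilon> in at_right 0. S \<epsilon> (x \<epsilon>)"
    "\<And>t. t \<in> A \<Longrightarrow> ((\<lambda>\<epsilon>. x \<epsilon> t) \<longlongrightarrow> y t) (at_right 0)"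
proof -
  define I where "I \<epsilon> = {d. d > 0 \<and> (\<exists>x. S \<epsilon> x \<and> (\<forall>t\<in>A. norm (x t - y t) \<le> d))}" for \<epsilon>
  have bdd: "bdd_below (I \<epsilon>)" for \<epsilon> by (rule bdd_belowI[of _ 0]) (auto simp: I_def)
  have "\<exists>x. 0 < \<epsilon> \<longrightarrow> I \<epsilon> \<noteq> {} \<longrightarrow> S \<epsilon> x \<and> (\<forall>t\<in>A. norm (x t - y t) \<le> Inf (I \<epsilon>) + \<epsilon>)" for \<epsilon>
  proof (cases "0 < \<epsilon> \<and> I \<epsilon> \<noteq> {}")
    case True
    then obtain d where d: "d \<in> I \<epsilon>" "d < Inf (I \<epsilon>) + \<epsilon>"
      using cInf_lessD[of "I \<epsilon>" "Inf (I \<epsilon>) + \<epsilon>"] by auto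
    then obtain x where "S \<epsilon> x" "\<forall>t\<in>A. norm (x t - y t) \<le> d" unfolding I_def by blast
    then show ?thesis using d(2) by (intro exI[of _ x]) force
  qed auto
  then obtain x where x: "\<And>\<epsilon>. 0 < \<epsilon> \<Longrightarrow> I \<epsilon> \<noteq> {} \<Longrightarrow>
      S \<epsilon> (x \<epsilon>) \<and> (\<forall>t\<in>A. norm (x \<epsilon> t - y t) \<le> Inf (I \<epsilon>) + \<epsilon>)" by metis
  have pos: "\<forall>\<^sub>F \<epsilon> in at_right (0::real). 0 < \<epsilon>" by (rule eventually_at_right_less)
  have ev: "\<forall>\<^sub>F \<epsilon> in at_right 0. d \<in> I \<epsilon>" if "d > 0" for d
    using assms[OF that] by eventually_elim (use that in \<open>auto simp: I_def\<close>)
  show thesis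
  proof
    show "\<forall>\<^sub>F \<epsilon> in at_right 0. S \<epsilon> (x \<epsilon>)"
      using ev[OF zero_less_one] pos by eventually_elim (use x in blast)
    show "((\<lambda>\<epsilon>. x \<epsilon> t) \<longlongrightarrow> y t) (at_right 0)" if t: "t \<in> A" for t
    proof (rule tendstoI)
      fix e :: real assume e: "e > 0"
      have "\<forall>\<^sub>F \<epsilon> in at_right 0. \<epsilon> < e / 2"
        using e by (intro eventually_at_right_field[THEN iffD2] exI[of _ "e / 2"]) auto
      moreover have "\<forall>\<^sub>F \<epsilon> in at_right 0. e / 2 \<in> I \<epsilon>" using e by (intro ev) simp
      ultimately show "\<forall>\<^sub>F \<epsilon> in at_right 0. dist (x \<epsilon> t) (y t) < e"
        using pos
      proof eventually_elim
        case (elim \<epsilon>)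
        have "Inf (I \<epsilon>) \<le> e / 2" by (rule cInf_lower[OF elim(2) bdd])
        moreover have "norm (x \<epsilon> t - y t) \<le> Inf (I \<epsilon>) + \<epsilon>" using x[of \<epsilon>] elim t by blast
        ultimately show ?case using elim(1) by (simp add: dist_norm)
      qed
    qed
  qed
qed

context perturbed_limit_cycle
begin

text \<open>The distance to the shifted cycle is at most the oscillation of \<open>x\<^sub>0\<close> over a phase shift of \<open>\<delta>\<close> plus
\<open>CY K \<epsilon>\<close>; first \<open>\<delta>\<close> and then \<open>\<epsilon>\<close> is made small.\<close>

lemma perturbed_solution_near_shifted_cycle:
  assumes N: "negligible N" "\<And>t x \<epsilon>. t \<notin> N \<Longrightarrow> \<Phi> t x \<epsilon> = \<phi> t x \<epsilon>"
    and \<eta>: "\<eta> > 0"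
    and sign: "\<And>\<delta>. 0 < \<delta> \<Longrightarrow> \<delta> < \<eta> \<Longrightarrow> s * bifurcation (\<theta>0 + \<delta>) > 0 \<and> s * bifurcation (\<theta>0 - \<delta>) < 0"
    and d: "d > 0"
  shows "\<forall>\<^sub>F \<epsilon> in at_right 0. \<exists>x.
      caratheodory_periodic_solution T (\<lambda>t v. \<psi> v + \<epsilon> *\<^sub>R \<phi> t v \<epsilon>) x \<and>
      (\<forall>t\<in>{0..T}. norm (x t - x0 (t + \<theta>0)) \<le> d)"
proof -
  show ?thesis
  proof (rule boundary_problem_eventually_solvable[of \<theta>0])
    fix K CY :: real
    assume K: "K > 0" and CY: "CY > 0"
      "\<And>t \<theta> v. t \<in> {0..T} \<Longrightarrow> \<bar>\<theta> - \<theta>0\<bar> \<le> 1 \<Longrightarrow> norm (Y (t + \<theta>) *v v) \<le> CY * norm v"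
      and solve: "\<And>\<delta> s. 0 < \<delta> \<Longrightarrow> \<delta> \<le> 1 \<Longrightarrow> s * bifurcation (\<theta>0 + \<delta>) > 0 \<Longrightarrow> s * bifurcation (\<theta>0 - \<delta>) < 0 \<Longrightarrow>
        \<forall>\<^sub>F \<epsilon> in at_right 0. \<exists>\<theta> u. \<bar>\<theta> - \<theta>0\<bar> \<le> \<delta> \<and>
          (\<forall>t\<in>{0..T}. norm (u t) \<le> K * \<epsilon>) \<and> boundary_solution \<epsilon> \<theta> u"
    have "uniformly_continuous_on {\<theta>0 - 1..\<theta>0 + 1 + T} x0"
      by (rule compact_uniformly_continuous[OF x0_cont]) simp
    moreover have "d / 2 > 0" using d by simp
    ultimately obtain \<delta>0 where \<delta>0: "\<delta>0 > 0"
      "\<forall>a\<in>{\<theta>0 - 1..\<theta>0 + 1 + T}. \<forall>a'\<in>{\<theta>0 - 1..\<theta>0 + 1 + T}. dist a' a < \<delta>0 \<longrightarrow> dist (x0 a') (x0 a) < d / 2"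
      unfolding uniformly_continuous_on_def by metis
    define \<delta> where "\<delta> = min 1 (min (\<eta> / 2) (\<delta>0 / 2))"
    have \<delta>: "0 < \<delta>" "\<delta> \<le> 1" "\<delta> < \<eta>" "\<delta> < \<delta>0" using \<eta> \<delta>0(1) by (auto simp: \<delta>_def)
    have "\<forall>\<^sub>F \<epsilon> in at_right 0. CY * (K * \<epsilon>) < d / 2"
    proof -
      have "\<epsilon> < d / (2 * (CY * K)) \<Longrightarrow> CY * (K * \<epsilon>) < d / 2" for \<epsilon>
        using CY(1) K by (simp add: field_simps)
      then show ?thesis
        using CY(1) K d by (intro eventually_at_right_field[THEN iffD2] exI[of _ "d / (2 * (CY * K))"]) auto
    qed
    moreover have "\<forall>\<^sub>F \<epsilon> in at_right (0::real). 0 < \<epsilon>" by (rule eventually_at_right_less)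
    moreover note solve[OF \<delta>(1,2) sign[OF \<delta>(1,3), THEN conjunct1] sign[OF \<delta>(1,3), THEN conjunct2]]
    ultimately show ?thesis
    proof eventually_elim
      case (elim \<epsilon>)
      from elim(3) obtain \<theta> u where \<theta>: "\<bar>\<theta> - \<theta>0\<bar> \<le> \<delta>"
        and u': "\<forall>t\<in>{0..T}. norm (u t) \<le> K * \<epsilon>" and sol: "boundary_solution \<epsilon> \<theta> u"
        by (elim exE conjE)
      note u = bspec[OF u']
      have \<theta>1: "\<bar>\<theta> - \<theta>0\<bar> \<le> 1" using \<theta> \<delta> by linarith
      obtain x where x: "caratheodory_periodic_solution T (\<lambda>t v. \<psi> v + \<epsilon> *\<^sub>R \<phi> t v \<epsilon>) x"
        "\<forall>t\<in>{0..T}. x t = x0 (t + \<theta>) + Y (t + \<theta>) *v u t"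
        using periodic_solution_of_boundary_problem[where \<phi> = \<phi>, OF N(1) N(2)[of _ _ \<epsilon>] CY(1) CY(2)[OF _ \<theta>1] u sol]
        by blast
      have "norm (x t - x0 (t + \<theta>0)) \<le> d" if t: "t \<in> {0..T}" for t
      proof -
        have "t + \<theta> \<in> {\<theta>0 - 1..\<theta>0 + 1 + T}" "t + \<theta>0 \<in> {\<theta>0 - 1..\<theta>0 + 1 + T}" "dist (t + \<theta>) (t + \<theta>0) < \<delta>0"
          using t \<theta>1 \<theta> \<delta> by (auto simp: dist_real_def)
        then have "norm (x0 (t + \<theta>) - x0 (t + \<theta>0)) < d / 2"
          using \<delta>0(2) by (simp add: dist_norm)
        moreover have "norm (Y (t + \<theta>) *v u t) \<le> CY * (K * \<epsilon>)"
          using CY(2)[OF t \<theta>1, of "u t"] mult_left_mono[OF u[OF t] less_imp_le[OF CY(1)]] by linarith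
        moreover have split: "x t - x0 (t + \<theta>0) = (x0 (t + \<theta>) - x0 (t + \<theta>0)) + Y (t + \<theta>) *v u t"
          using bspec[OF x(2) t] by simp
        ultimately show ?thesis
          unfolding split
          using norm_triangle_ineq[of "x0 (t + \<theta>) - x0 (t + \<theta>0)" "Y (t + \<theta>) *v u t"] elim(1) by linarith
      qed
      then show ?case using x(1) by blast
    qed
  qed
qed

end

theorem corollary3p5:
  fixes T \<theta>0 :: real
    and \<psi> :: "real^'n \<Rightarrow> real^'n"
    and \<phi> :: "real \<Rightarrow> real^'n \<Rightarrow> real \<Rightarrow> real^'n"
    and x0 z0 :: "real \<Rightarrow> real^'n"
  assumes "T > 0"
    and "C1_vector_field \<psi>"
    and "caratheodory_perturbation T \<phi>"
    and "nondegenerate_limit_cycle T \<psi> x0"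
    and "nontrivial_periodic_adjoint_solution T \<psi> x0 z0"
    and "\<theta>0 \<in> {0..T}"
    and "malkin_function T \<phi> x0 z0 \<theta>0 = 0"
    and "strictly_monotone_at (malkin_function T \<phi> x0 z0) \<theta>0"
  shows "\<exists>x :: real \<Rightarrow> real \<Rightarrow> real^'n.
    (\<forall>\<^sub>F \<epsilon> in at_right 0.
       caratheodory_periodic_solution T (\<lambda>t v. \<psi> v + \<epsilon> *\<^sub>R \<phi> t v \<epsilon>) (x \<epsilon>)) \<and>
    (\<forall>t\<in>{0..T}. ((\<lambda>\<epsilon>. x \<epsilon> t) \<longlongrightarrow> x0 (t + \<theta>0)) (at_right 0))"
proof -
  let ?f = "malkin_function T \<phi> x0 z0"
  have x0_sol: "classical_periodic_solution T (\<lambda>t x. \<psi> x) x0"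
    and mult: "characteristic_multiplier (\<lambda>t. jacobian \<psi> (at (x0 t))) T 1 1"
    using assms(4) unfolding nondegenerate_limit_cycle_def by blast+
  obtain Y where Y: "Y 0 = mat 1"
    "\<And>t. (Y has_vector_derivative (jacobian \<psi> (at (x0 t)) ** Y t)) (at t)"
    "order 1 (characteristic_polynomial (Y T)) = 1"
    using mult unfolding characteristic_multiplier_def monodromy_matrix_def by blast
  have z0_sol: "classical_periodic_solution T
       (\<lambda>t z. - (transpose (jacobian \<psi> (at (x0 t))) *v z)) z0"
    using assms(5) unfolding nontrivial_periodic_adjoint_solution_def by blast
  obtain \<eta> where \<eta>: "\<eta> > 0" and mono:
    "(\<forall>\<theta>. 0 < \<bar>\<theta> - \<theta>0\<bar> \<and> \<bar>\<theta> - \<theta>0\<bar> < \<eta> \<longrightarrow> (?f \<theta> - ?f \<theta>0) * (\<theta> - \<theta>0) > 0) \<or>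
     (\<forall>\<theta>. 0 < \<bar>\<theta> - \<theta>0\<bar> \<and> \<bar>\<theta> - \<theta>0\<bar> < \<eta> \<longrightarrow> (?f \<theta> - ?f \<theta>0) * (\<theta> - \<theta>0) < 0)"
    using assms(8) unfolding strictly_monotone_at_def by blast
  \<comment> \<open>Both kinds of strict monotonicity become the increasing case after multiplication by \<open>\<sigma>\<close>.\<close>
  obtain \<sigma> :: real where \<sigma>: "\<And>\<delta>. 0 < \<delta> \<Longrightarrow> \<delta> < \<eta> \<Longrightarrow> \<sigma> * ?f (\<theta>0 + \<delta>) > 0 \<and> \<sigma> * ?f (\<theta>0 - \<delta>) < 0"
  proof (cases "\<forall>\<theta>. 0 < \<bar>\<theta> - \<theta>0\<bar> \<and> \<bar>\<theta> - \<theta>0\<bar> < \<eta> \<longrightarrow> (?f \<theta> - ?f \<theta>0) * (\<theta> - \<theta>0) > 0")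
    case True
    show thesis
    proof (rule that[of 1])
      show "1 * ?f (\<theta>0 + \<delta>) > 0 \<and> 1 * ?f (\<theta>0 - \<delta>) < 0" if "0 < \<delta>" "\<delta> < \<eta>" for \<delta>
        using True[rule_format, of "\<theta>0 + \<delta>"] True[rule_format, of "\<theta>0 - \<delta>"] that assms(7)
        by (auto simp: zero_less_mult_iff mult_less_0_iff)
    qed
  next
    case False
    then have neg: "\<forall>\<theta>. 0 < \<bar>\<theta> - \<theta>0\<bar> \<and> \<bar>\<theta> - \<theta>0\<bar> < \<eta> \<longrightarrow> (?f \<theta> - ?f \<theta>0) * (\<theta> - \<theta>0) < 0"
      using mono by blast
    show thesis
    proof (rule that[of "- 1"])
      show "- 1 * ?f (\<theta>0 + \<delta>) > 0 \<and> - 1 * ?f (\<theta>0 - \<delta>) < 0" if "0 < \<delta>" "\<delta> < \<eta>" for \<delta>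
        using neg[rule_format, of "\<theta>0 + \<delta>"] neg[rule_format, of "\<theta>0 - \<delta>"] that assms(7)
        by (auto simp: zero_less_mult_iff mult_less_0_iff)
    qed
  qed
  have velocity: "vector_derivative x0 (at 0) = \<psi> (x0 0)"
    using x0_sol vector_derivative_at unfolding classical_periodic_solution_def by blast
  have transversal: "\<psi> (x0 0) \<bullet> z0 0 \<noteq> 0"
  proof
    assume "\<psi> (x0 0) \<bullet> z0 0 = 0"
    then have "?f \<theta> = 0" for \<theta> by (simp add: malkin_function_def velocity)
    then show False using \<sigma>[of "\<eta> / 2"] \<eta> by simp
  qed
  interpret limit_cycle T \<psi> x0 z0 Y
    by unfold_locales (use assms(1,2) x0_sol Y z0_sol transversal in auto)
  obtain r where r: "r > 0" "\<And>t. norm (x0 t) \<le> r"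
    using bounded_range_x0 unfolding bounded_pos by auto
  have r1: "r + 1 > 0" using r by simp
  show ?thesis
  proof (rule caratheodory_perturbation_regularize[OF assms(3) r1])
    fix \<Phi> :: "real \<Rightarrow> real^'n \<Rightarrow> real \<Rightarrow> real^'n" and b :: "real \<Rightarrow> real" and N :: "real set"
    assume N: "negligible N" "\<And>t x \<epsilon>. t \<notin> N \<Longrightarrow> \<Phi> t x \<epsilon> = \<phi> t x \<epsilon>"
      and \<Phi>: "\<And>x \<epsilon>. \<epsilon> \<in> {0..1} \<Longrightarrow> (\<lambda>t. \<Phi> t x \<epsilon>) \<in> borel_measurable (lebesgue_on {0..T})"
        "\<And>t. continuous_on (UNIV \<times> {0..1}) (\<lambda>(x, \<epsilon>). \<Phi> t x \<epsilon>)"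
        "b integrable_on {0..T}" "\<And>t. t \<in> {0..T} \<Longrightarrow> 0 \<le> b t"
        "\<And>t x \<epsilon>. t \<in> {0..T} \<Longrightarrow> norm x \<le> r + 1 \<Longrightarrow> \<epsilon> \<in> {0..1} \<Longrightarrow> norm (\<Phi> t x \<epsilon>) \<le> b t"
    interpret perturbed_limit_cycle T \<psi> x0 z0 Y \<Phi> b r
      by unfold_locales (fact r(2) \<Phi>)+
    have f_eq: "?f \<theta> = sgn (\<psi> (x0 0) \<bullet> z0 0) * bifurcation \<theta>" for \<theta>
    proof (rule malkin_function_eq_bifurcation[where \<phi> = \<phi>, OF _ N(1) N(2)[of _ _ 0]])
      show "T_periodic T (\<lambda>t. \<phi> t x 0)" for x
        using assms(3) unfolding caratheodory_perturbation_def by simp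
    qed
    have sign: "\<sigma> * sgn (\<psi> (x0 0) \<bullet> z0 0) * bifurcation (\<theta>0 + \<delta>) > 0 \<and>
        \<sigma> * sgn (\<psi> (x0 0) \<bullet> z0 0) * bifurcation (\<theta>0 - \<delta>) < 0" if "0 < \<delta>" "\<delta> < \<eta>" for \<delta>
      using \<sigma>[OF that] by (simp add: f_eq mult.assoc)
    obtain x where "\<forall>\<^sub>F \<epsilon> in at_right 0.
         caratheodory_periodic_solution T (\<lambda>t v. \<psi> v + \<epsilon> *\<^sub>R \<phi> t v \<epsilon>) (x \<epsilon>)"
      "\<And>t. t \<in> {0..T} \<Longrightarrow> ((\<lambda>\<epsilon>. x \<epsilon> t) \<longlongrightarrow> x0 (t + \<theta>0)) (at_right 0)"
      using choose_convergent_family[of "\<lambda>\<epsilon>. caratheodory_periodic_solution T (\<lambda>t v. \<psi> v + \<epsilon> *\<^sub>R \<phi> t v \<epsilon>)"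
          "{0..T}" "\<lambda>t. x0 (t + \<theta>0)", OF perturbed_solution_near_shifted_cycle[OF N \<eta> sign]]
      by blast
    then show ?thesis by blast
  qed
qed

end
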